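(* Let $A=(a,b,c,d,u_0,w_0)$ be real parameters with $ad-bc=1$ and $b\neq 0$. Let $\phi,\psi\in L^2(\mathbb{R})\setminus\{0\}$ be window functions with $\langle\psi,\phi\rangle\neq 0$, and let $f\in L^2(\mathbb{R})$. Then $$f(t)=\frac{1}{\langle\psi,\phi\rangle}\,e^{i\frac{cd}{2}u_0^2-iadu_0w_0+i\frac{ab}{2}w_0}\int_{\mathbb{R}^2}V^{A}_{\phi}f(u,w)\,K_{A^{-1}}(u,t)\,\psi(t-w)\,du\,dw .$$
   Context: The inner product is $\langle f,g\rangle=\int_{\mathbb{R}}f(t)\overline{g(t)}\,dt$. For real parameters $A=(a,b,c,d,u_0,w_0)$ with $ad-bc=1$, $b\neq 0$, the offset linear canonical transform kernel is $$K_A(t,u)=\frac{1}{\sqrt{i2\pi b}}\exp\Big(i\frac{a}{2b}t^2-i\frac1b t(u-u_0)-i\frac1b u(du_0-bw_0)+i\frac{d}{2b}(u^2+u_0^2)\Big).$$ The inverse parameters are $A^{-1}=(d,-b,-c,a,\;bw_0-du_0,\;cu_0-aw_0)$, and $K_{A^{-1}}(u,t)$ is the same kernel with the six parameters $A^{-1}$ in place of $A$, first variable $u$ and second variable $t$. The windowed offset linear canonical transform of $f\in L^2(\mathbb{R})$ with window $\phi\in L^2(\mathbb{R})\setminus\{0\}$ is $$V^A_\phi f(u,w)=\int_{\mathbb{R}} f(t)\,\overline{\phi(t-w)}\,K_A(t,u)\,dt .$$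
   Formalization: The last phase term i(ab/2)w_0 is corrected to i(ab/2)w_0^2 (the printed one fails e.g. for A=(1,1,0,1,0,2), f≠0); the integral over R^2 is read as the L^2-limit of integrals along every increasing compact exhaustion, and equality as almost everywhere. *)

theory Defs
  imports "HOL-Analysis.Analysis"
begin

definition square_integrable :: "(real \<Rightarrow> complex) \<Rightarrow> bool" where
  "square_integrable f \<longleftrightarrow>
     f \<in> borel_measurable lborel \<and> integrable lborel (\<lambda>t. (cmod (f t))\<^sup>2)"

definition L2_inner :: "(real \<Rightarrow> complex) \<Rightarrow> (real \<Rightarrow> complex) \<Rightarrow> complex" where
  "L2_inner f g = (LINT t|lborel. f t * cnj (g t))"

definition L2_norm :: "(real \<Rightarrow> complex) \<Rightarrow> real" where
  "L2_norm f = sqrt (LINT t|lborel. (cmod (f t))\<^sup>2)"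


text \<open>Parameters are tuples \<open>(a, b, c, d, u0, w0)\<close>. The square root in the kernel is the
  principal one.\<close>

type_synonym olct_params = "real \<times> real \<times> real \<times> real \<times> real \<times> real"

fun olct_kernel :: "olct_params \<Rightarrow> real \<Rightarrow> real \<Rightarrow> complex" where
  "olct_kernel (a, b, c, d, u0, w0) t u =
     1 / csqrt (\<i> * complex_of_real (2 * pi * b)) *
     exp (\<i> * complex_of_real (a / (2 * b) * t\<^sup>2)
          - \<i> * complex_of_real (1 / b * t * (u - u0))
          - \<i> * complex_of_real (1 / b * u * (d * u0 - b * w0))
          + \<i> * complex_of_real (d / (2 * b) * (u\<^sup>2 + u0\<^sup>2)))"

fun olct_inverse :: "olct_params \<Rightarrow> olct_params" where
  "olct_inverse (a, b, c, d, u0, w0) = (d, -b, -c, a, b * w0 - d * u0, c * u0 - a * w0)"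

definition windowed_olct ::
  "olct_params \<Rightarrow> (real \<Rightarrow> complex) \<Rightarrow> (real \<Rightarrow> complex) \<Rightarrow> real \<Rightarrow> real \<Rightarrow> complex" where
  "windowed_olct A \<phi> f u w =
     (LINT t|lborel. f t * cnj (\<phi> (t - w)) * olct_kernel A t u)"


text \<open>The kernel of the inverse parameters is the conjugate kernel up to a unimodular constant.
  That constant contains \<open>w0\<^sup>2\<close>, which fixes the phase factor of the inversion formula.\<close>

lemma olct_kernel_inverse:
  assumes "a * d - b * c = 1" and "b \<noteq> 0"
  shows "exp (\<i> * complex_of_real (c * d / 2 * u0\<^sup>2) - \<i> * complex_of_real (a * d * u0 * w0)
              + \<i> * complex_of_real (a * b / 2 * w0\<^sup>2)) *
         olct_kernel (olct_inverse (a, b, c, d, u0, w0)) u t =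
         cnj (olct_kernel (a, b, c, d, u0, w0) t u)"
proof -
  have nn: "\<i> * complex_of_real (2 * pi * b) \<notin> \<real>\<^sub>\<le>\<^sub>0"
    using assms(2) by (auto simp: complex_nonpos_Reals_iff)
  have sq: "cnj (csqrt (\<i> * complex_of_real (2 * pi * b)))
            = csqrt (\<i> * complex_of_real (2 * pi * (- b)))"
    using cnj_csqrt[OF nn] by simp
  have real_eq: "c * d / 2 * u0\<^sup>2 - a * d * u0 * w0 + a * b / 2 * w0\<^sup>2
      + (d / (2 * (-b)) * u\<^sup>2 - 1 / (-b) * u * (t - (b * w0 - d * u0))
         - 1 / (-b) * t * (a * (b * w0 - d * u0) - (-b) * (c * u0 - a * w0))
         + a / (2 * (-b)) * (t\<^sup>2 + (b * w0 - d * u0)\<^sup>2))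
      = - (a / (2 * b) * t\<^sup>2 - 1 / b * t * (u - u0) - 1 / b * u * (d * u0 - b * w0)
         + d / (2 * b) * (u\<^sup>2 + u0\<^sup>2))" (is "?L1 + ?L2 = - ?R")
  proof -
    have bc: "b * c = a * d - 1" using assms(1) by simp
    have c: "c = (a * d - 1) / b" using bc assms(2) by (simp add: field_simps)
    show ?thesis unfolding c using assms(2)
      by (simp add: field_simps power2_eq_square)
  qed
  have phase: "\<i> * complex_of_real x - \<i> * complex_of_real y + \<i> * complex_of_real z
                = \<i> * complex_of_real (x - y + z)" for x y z
    by (simp add: algebra_simps)
  have ker: "\<i> * complex_of_real x - \<i> * complex_of_real y - \<i> * complex_of_real z + \<i> * complex_of_real v
              = \<i> * complex_of_real (x - y - z + v)" for x y z v
    by (simp add: algebra_simps)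
  have prod: "exp (\<i> * complex_of_real ?L1) * exp (\<i> * complex_of_real ?L2)
        = exp (\<i> * complex_of_real (- ?R))"
    by (simp only: exp_add [symmetric] distrib_left [symmetric] of_real_add [symmetric] real_eq)
  have conj: "cnj (exp (\<i> * complex_of_real ?R)) = exp (\<i> * complex_of_real (- ?R))"
    by (simp only: exp_cnj complex_cnj_mult complex_cnj_i complex_cnj_complex_of_real
        of_real_minus mult_minus_left mult_minus_right)
  show ?thesis
    unfolding olct_inverse.simps olct_kernel.simps phase ker complex_cnj_mult complex_cnj_divide
      sq complex_cnj_one conj prod [symmetric]
    by (simp only: mult.left_commute)
qed


text \<open>
  For \<open>f\<close> in \<open>L\<^sup>2\<close> the integrand of the inversion formula need not be Lebesgue
  integrable over the plane for any fixed \<open>t\<close>, so an integral over the plane of a family of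
  functions of \<open>t\<close> is understood as an \<open>L\<^sup>2\<close>-valued improper integral: the integrals
  over compact sets, which are honest Lebesgue integrals for almost every \<open>t\<close>, converge in
  \<open>L\<^sup>2\<close> norm along every increasing exhaustion by compact sets.
\<close>

definition compact_exhaustion :: "(nat \<Rightarrow> 'a::topological_space set) \<Rightarrow> bool" where
  "compact_exhaustion K \<longleftrightarrow> (\<forall>n. compact (K n)) \<and> incseq K \<and> (\<Union>n. K n) = UNIV"

definition has_L2_integral ::
  "('a::euclidean_space \<Rightarrow> real \<Rightarrow> complex) \<Rightarrow> (real \<Rightarrow> complex) \<Rightarrow> bool" where
  "has_L2_integral F h \<longleftrightarrow> square_integrable h \<and>
     (\<forall>K. compact_exhaustion K \<longrightarrow>
        (\<forall>n. (AE t in lborel. set_integrable lborel (K n) (\<lambda>x. F x t)) \<and>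
             square_integrable (\<lambda>t. LINT x:K n|lborel. F x t)) \<and>
        (\<lambda>n. L2_norm (\<lambda>t. (LINT x:K n|lborel. F x t) - h t)) \<longlonglongrightarrow> 0)"

lemma square_integrable_diff:
  assumes "square_integrable f" and "square_integrable g"
  shows "square_integrable (\<lambda>t. f t - g t)"
proof -
  have [measurable]: "f \<in> borel_measurable lborel" "g \<in> borel_measurable lborel"
    and i: "integrable lborel (\<lambda>t. 2 * (cmod (f t))\<^sup>2 + 2 * (cmod (g t))\<^sup>2)"
    using assms by (auto simp: square_integrable_def)
  have "(cmod (f t - g t))\<^sup>2 \<le> 2 * (cmod (f t))\<^sup>2 + 2 * (cmod (g t))\<^sup>2" for t
  proof -
    have "(cmod (f t - g t))\<^sup>2 \<le> (cmod (f t) + cmod (g t))\<^sup>2"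
      by (intro power_mono norm_triangle_ineq4) auto
    also have "\<dots> \<le> 2 * (cmod (f t))\<^sup>2 + 2 * (cmod (g t))\<^sup>2"
      using sum_squares_bound [of "cmod (f t)" "cmod (g t)"] by (simp add: power2_sum)
    finally show ?thesis .
  qed
  then have "integrable lborel (\<lambda>t. (cmod (f t - g t))\<^sup>2)"
    by (intro Bochner_Integration.integrable_bound [OF i]) auto
  then show ?thesis by (simp add: square_integrable_def)
qed

text \<open>Wherever the Lebesgue integral over the whole space exists, it is the value of the
  \<open>L\<^sup>2\<close>-valued integral, up to a null set.\<close>

lemma has_L2_integral_AE_eq_lebesgue_integral:
  assumes "has_L2_integral F h"
  shows "AE t in lborel. integrable lborel (\<lambda>x. F x t) \<longrightarrow> h t = (LINT x|lborel. F x t)"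
proof -
  let ?K = "\<lambda>n. cball 0 (real n) :: 'a set"
  let ?g = "\<lambda>n t. LINT x:?K n|lborel. F x t"
  have "\<exists>n. norm x \<le> real n" for x :: 'a by (rule real_arch_simple)
  then have ex: "compact_exhaustion ?K"
    by (auto simp: compact_exhaustion_def incseq_def)
  have sq: "square_integrable (\<lambda>t. ?g n t - h t)" for n
    using assms ex unfolding has_L2_integral_def by (intro square_integrable_diff) blast+
  have int: "integrable lborel (\<lambda>t. (cmod (?g n t - h t))\<^sup>2)" for n
    using sq unfolding square_integrable_def by blast
  have "(\<lambda>n. L2_norm (\<lambda>t. ?g n t - h t)) \<longlonglongrightarrow> 0"
    using assms ex unfolding has_L2_integral_def by blast
  from tendsto_power [OF this, of 2]
  have lim: "(\<lambda>n. LINT t|lborel. norm ((cmod (?g n t - h t))\<^sup>2)) \<longlonglongrightarrow> 0"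
    by (simp add: L2_norm_def)
  from tendsto_L1_AE_subseq [OF int lim]
  obtain r :: "nat \<Rightarrow> nat" where r: "strict_mono r"
    and ae: "AE t in lborel. (\<lambda>n. (cmod (?g (r n) t - h t))\<^sup>2) \<longlonglongrightarrow> 0" by blast
  from ae show ?thesis
  proof eventually_elim
    case (elim t)
    show ?case
    proof
      assume i: "integrable lborel (\<lambda>x. F x t)"
      have "(\<lambda>n. ?g n t) \<longlonglongrightarrow> (LINT x:(\<Union>n. ?K n)|lborel. F x t)"
        using ex i by (intro set_integral_cont_up)
          (auto simp: compact_exhaustion_def set_integrable_def)
      then have "(\<lambda>n. ?g n t) \<longlonglongrightarrow> (LINT x|lborel. F x t)"
        using ex by (simp add: compact_exhaustion_def set_lebesgue_integral_def)
      then have 1: "(\<lambda>n. ?g (r n) t) \<longlonglongrightarrow> (LINT x|lborel. F x t)"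
        using LIMSEQ_subseq_LIMSEQ [OF _ r] by (fastforce simp: o_def)
      have "(\<lambda>n. cmod (?g (r n) t - h t)) \<longlonglongrightarrow> 0"
        using tendsto_real_sqrt [OF elim] by simp
      then have "(\<lambda>n. ?g (r n) t) \<longlonglongrightarrow> h t"
        by (simp add: LIM_zero_iff tendsto_norm_zero_iff)
      then show "h t = (LINT x|lborel. F x t)" using 1 by (rule LIMSEQ_unique)
    qed
  qed
qed

end

theory Submission
  imports Defs "HOL-Probability.Characteristic_Functions"
begin

text \<open>
  The kernel is a product of chirps with the Fourier kernel at \<open>u / b\<close>, so the transform
  inherits Parseval's formula from the Fourier transform. Applying it to
  \<open>f t * cnj (\<phi> (t - w))\<close> for almost every \<open>w\<close> and integrating over \<open>w\<close> gives
  \<open>\<langle>V\<^sub>\<phi> f, V\<^sub>\<psi> k\<rangle> = \<langle>f, k\<rangle> \<langle>\<psi>, \<phi>\<rangle>\<close>.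
  Since the inverse kernel is a unimodular multiple of the conjugate kernel, the integral over a
  compact set \<open>K\<close> is, up to that constant, the adjoint of \<open>V\<^sub>\<psi>\<close> applied to
  \<open>V\<^sub>\<phi> f\<close> restricted to \<open>K\<close>. Hence its \<open>L\<^sup>2\<close> distance to
  \<open>\<langle>\<psi>, \<phi>\<rangle> f\<close> is at most \<open>\<parallel>\<psi>\<parallel>\<close> times the \<open>L\<^sup>2\<close> norm of \<open>V\<^sub>\<phi> f\<close> outside
  \<open>K\<close>, which tends to zero along every exhaustion.

  Parseval's formula itself comes from a Gaussian summability factor: the smoothed integral is an
  average of the correlations of \<open>F\<close> with small translates of \<open>G\<close>.
\<close>

subsection \<open>Square-integrable functions on a measure space\<close>

text \<open>The measure is a parameter because the same estimates serve on the line, on the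
  time-frequency plane and on the product of the plane with the line.\<close>

definition L2_on :: "'a measure \<Rightarrow> ('a \<Rightarrow> complex) \<Rightarrow> bool" where
  "L2_on M f \<longleftrightarrow> f \<in> borel_measurable M \<and> integrable M (\<lambda>x. (cmod (f x))\<^sup>2)"

lemma square_integrable_eq_L2_on: "square_integrable f \<longleftrightarrow> L2_on lborel f"
  by (simp add: square_integrable_def L2_on_def)

lemma L2_on_measurable: "L2_on M f \<Longrightarrow> f \<in> borel_measurable M"
  and L2_on_integrable: "L2_on M f \<Longrightarrow> integrable M (\<lambda>x. (cmod (f x))\<^sup>2)"
  by (simp_all add: L2_on_def)

lemma L2_on_bound:
  assumes "L2_on M g" "f \<in> borel_measurable M" "AE x in M. cmod (f x) \<le> cmod (g x)"
  shows "L2_on M f"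
  unfolding L2_on_def
proof
  show "integrable M (\<lambda>x. (cmod (f x))\<^sup>2)"
    by (rule Bochner_Integration.integrable_bound [OF L2_on_integrable [OF assms(1)]])
       (use assms(2,3) in \<open>auto intro: power_mono\<close>)
qed (rule assms)

lemma L2_on_mult_integrable:
  assumes "L2_on M f" "L2_on M g"
  shows "integrable M (\<lambda>x. f x * g x)"
proof (rule Bochner_Integration.integrable_bound)
  show "integrable M (\<lambda>x. (cmod (f x))\<^sup>2 + (cmod (g x))\<^sup>2)"
    using assms by (simp add: L2_on_def)
  show "(\<lambda>x. f x * g x) \<in> borel_measurable M"
    using assms by (auto simp: L2_on_def)
  have "cmod (f x) * cmod (g x) \<le> (cmod (f x))\<^sup>2 + (cmod (g x))\<^sup>2" for x
    using sum_squares_bound [of "cmod (f x)" "cmod (g x)"] zero_le_power2 [of "cmod (f x)"]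
      zero_le_power2 [of "cmod (g x)"] by linarith
  then show "AE x in M. norm (f x * g x) \<le> norm ((cmod (f x))\<^sup>2 + (cmod (g x))\<^sup>2)"
    by (auto simp: norm_mult)
qed

lemma borel_measurable_cnj [measurable (raw)]:
  "f \<in> borel_measurable M \<Longrightarrow> (\<lambda>x. cnj (f x)) \<in> borel_measurable M"
  by (rule borel_measurable_continuous_on [OF _ , where f = cnj]) (auto intro: continuous_intros)

lemma L2_on_cnj: "L2_on M f \<Longrightarrow> L2_on M (\<lambda>x. cnj (f x))"
  by (rule L2_on_bound [of M f]) (auto simp: L2_on_def)

lemma L2_on_cmult: "L2_on M f \<Longrightarrow> L2_on M (\<lambda>x. c * f x)"
  by (auto simp: L2_on_def norm_mult power_mult_distrib)

lemma L2_on_diff: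
  assumes "L2_on M f" "L2_on M g"
  shows "L2_on M (\<lambda>x. f x - g x)"
proof -
  have i: "integrable M (\<lambda>x. 2 * (cmod (f x))\<^sup>2 + 2 * (cmod (g x))\<^sup>2)"
    using assms by (auto simp: L2_on_def)
  have "(cmod (f t - g t))\<^sup>2 \<le> 2 * (cmod (f t))\<^sup>2 + 2 * (cmod (g t))\<^sup>2" for t
  proof -
    have "(cmod (f t - g t))\<^sup>2 \<le> (cmod (f t) + cmod (g t))\<^sup>2"
      by (intro power_mono norm_triangle_ineq4) auto
    also have "\<dots> \<le> 2 * (cmod (f t))\<^sup>2 + 2 * (cmod (g t))\<^sup>2"
      using sum_squares_bound [of "cmod (f t)" "cmod (g t)"] by (simp add: power2_sum)
    finally show ?thesis .
  qed
  then show ?thesis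
    using assms unfolding L2_on_def
    by (auto intro!: Bochner_Integration.integrable_bound [OF i])
qed

text \<open>Integrating \<open>(s * cmod (f x) - cmod (g x))^2 \<ge> 0\<close> gives one inequality
  for each real \<open>s\<close>, and a suitable \<open>s\<close> yields the claim. With the moduli
  inside the integral, the bound is of use in Fubini arguments.\<close>

lemma norm_integral_mult_le:
  assumes "L2_on M f" "L2_on M g"
  shows "(LINT x|M. cmod (f x) * cmod (g x)) \<le>
     sqrt (LINT x|M. (cmod (f x))\<^sup>2) * sqrt (LINT x|M. (cmod (g x))\<^sup>2)"
proof -
  define F where "F = (LINT x|M. (cmod (f x))\<^sup>2)"
  define G where "G = (LINT x|M. (cmod (g x))\<^sup>2)"
  define I where "I = (LINT x|M. cmod (f x) * cmod (g x))"
  have nn: "F \<ge> 0" "G \<ge> 0" "I \<ge> 0" by (auto simp: F_def G_def I_def)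
  have int: "integrable M (\<lambda>x. cmod (f x) * cmod (g x))"
    using integrable_norm [OF L2_on_mult_integrable [OF assms]] by (simp add: norm_mult)
  have key: "2 * s * I \<le> s\<^sup>2 * F + G" for s
  proof -
    have "(LINT x|M. 2 * s * (cmod (f x) * cmod (g x))) \<le>
          (LINT x|M. s\<^sup>2 * (cmod (f x))\<^sup>2 + (cmod (g x))\<^sup>2)"
    proof (rule integral_mono)
      show "2 * s * (cmod (f x) * cmod (g x)) \<le> s\<^sup>2 * (cmod (f x))\<^sup>2 + (cmod (g x))\<^sup>2" for x
        using sum_squares_bound [of "s * cmod (f x)" "cmod (g x)"]
        by (simp add: power_mult_distrib mult_ac)
    qed (use assms int in \<open>auto simp: L2_on_def\<close>)
    then show ?thesis
      using assms by (simp add: I_def F_def G_def L2_on_def)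
  qed
  have "I\<^sup>2 \<le> F * G"
  proof (cases "F = 0")
    case True
    have "I = 0"
    proof (rule ccontr)
      assume "I \<noteq> 0"
      then show False using key [of "(G + 1) / I"] nn True by simp
    qed
    then show ?thesis using nn by simp
  next
    case False
    \<comment> \<open>The choice \<open>s = I / F\<close> minimises
      \<open>s^2 * F - 2 * s * I\<close>.\<close>
    then have "I\<^sup>2 / F \<le> G" using key [of "I / F"] nn by (simp add: power2_eq_square field_simps)
    then show ?thesis using False nn by (simp add: field_simps)
  qed
  then show ?thesis
    unfolding F_def [symmetric] G_def [symmetric] I_def [symmetric] real_sqrt_mult [symmetric]
    by (rule real_le_rsqrt)
qed

lemma Cauchy_Schwarz_L2_on:
  assumes "L2_on M f" "L2_on M g"
  shows "cmod (LINT x|M. f x * g x) \<le>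
     sqrt (LINT x|M. (cmod (f x))\<^sup>2) * sqrt (LINT x|M. (cmod (g x))\<^sup>2)"
proof -
  have "cmod (LINT x|M. f x * g x) \<le> (LINT x|M. cmod (f x * g x))"
    by (rule integral_norm_bound)
  also have "\<dots> \<le> sqrt (LINT x|M. (cmod (f x))\<^sup>2) * sqrt (LINT x|M. (cmod (g x))\<^sup>2)"
    using norm_integral_mult_le [OF assms] by (simp add: norm_mult)
  finally show ?thesis .
qed

subsection \<open>Continuity of translations in \<open>L\<^sup>1\<close> and \<open>L\<^sup>2\<close>\<close>

lemma integrable_lborel_shift:
  fixes g :: "real \<Rightarrow> 'b::{banach, second_countable_topology}"
  assumes "integrable lborel g"
  shows "integrable lborel (\<lambda>x. g (x - z))"
  using lborel_integrable_real_affine [OF assms, of 1 "- z"] by simp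

lemma integral_lborel_shift:
  fixes g :: "real \<Rightarrow> 'b::{banach, second_countable_topology}"
  shows "(LINT x|lborel. g (x - z)) = (LINT x|lborel. g x)"
  using lborel_integral_real_affine [of 1 g "- z"] by simp

lemma L2_on_shift:
  fixes f :: "real \<Rightarrow> complex"
  assumes "L2_on lborel f"
  shows "L2_on lborel (\<lambda>x. f (x - z))"
  using assms integrable_lborel_shift [of "\<lambda>x. (cmod (f x))\<^sup>2" z]
  by (auto simp: L2_on_def)

text \<open>By translation invariance the translates of \<open>g\<close> and \<open>h\<close> are as
  far apart as \<open>g\<close> and \<open>h\<close> themselves, hence the factor 2.\<close>

lemma L1_shift_triangle:
  fixes g h :: "real \<Rightarrow> 'b::{banach, second_countable_topology}"
  assumes g: "integrable lborel g" and h: "integrable lborel h"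
  shows "(LINT x|lborel. norm (g (x - z) - g x)) \<le>
         (LINT x|lborel. norm (h (x - z) - h x)) + 2 * (LINT x|lborel. norm (g x - h x))"
proof -
  have shift: "integrable lborel (\<lambda>x. g (x - z))" "integrable lborel (\<lambda>x. h (x - z))"
    by (fact g [THEN integrable_lborel_shift] h [THEN integrable_lborel_shift])+
  have gh: "integrable lborel (\<lambda>x. norm (g x - h x))"
    and gh': "integrable lborel (\<lambda>x. norm (g (x - z) - h (x - z)))"
    and g': "integrable lborel (\<lambda>x. norm (g (x - z) - g x))"
    and h': "integrable lborel (\<lambda>x. norm (h (x - z) - h x))"
    by (intro integrable_norm Bochner_Integration.integrable_diff g h shift)+
  have "(LINT x|lborel. norm (g (x - z) - g x)) \<le>
    (LINT x|lborel. norm (h (x - z) - h x) + (norm (g (x - z) - h (x - z)) + norm (g x - h x)))"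
  proof (rule integral_mono)
    fix x
    have "g (x - z) - g x = (h (x - z) - h x) + ((g (x - z) - h (x - z)) - (g x - h x))" by simp
    then show "norm (g (x - z) - g x) \<le>
       norm (h (x - z) - h x) + (norm (g (x - z) - h (x - z)) + norm (g x - h x))"
      using norm_triangle_ineq [of "h (x - z) - h x" "(g (x - z) - h (x - z)) - (g x - h x)"]
        norm_triangle_ineq4 [of "g (x - z) - h (x - z)" "g x - h x"] by simp
  qed (intro g' h' gh gh' Bochner_Integration.integrable_add)+
  also have "\<dots> = (LINT x|lborel. norm (h (x - z) - h x)) +
      ((LINT x|lborel. norm (g (x - z) - h (x - z))) + (LINT x|lborel. norm (g x - h x)))"
    by (simp only: Bochner_Integration.integral_add Bochner_Integration.integrable_add g' h' gh gh')
  also have "(LINT x|lborel. norm (g (x - z) - h (x - z))) = (LINT x|lborel. norm (g x - h x))"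
    by (rule integral_lborel_shift [of "\<lambda>x. norm (g x - h x)"])
  finally show ?thesis by simp
qed

text \<open>Good L1-approximants suffice because \<open>L1_shift_triangle\<close> controls the
  approximation error uniformly in the shift.\<close>

lemma L1_shift_limit_approx:
  fixes g :: "real \<Rightarrow> 'b::{banach, second_countable_topology}"
  assumes g: "integrable lborel g"
    and approx: "\<And>e. e > 0 \<Longrightarrow> \<exists>h. integrable lborel h \<and> (LINT x|lborel. norm (g x - h x)) \<le> e \<and>
      (\<lambda>n. LINT x|lborel. norm (h (x - z n) - h x)) \<longlonglongrightarrow> 0"
  shows "(\<lambda>n. LINT x|lborel. norm (g (x - z n) - g x)) \<longlonglongrightarrow> 0"
proof (rule LIMSEQ_I)
  fix r :: real assume "r > 0"
  then obtain h where h: "integrable lborel h" "(LINT x|lborel. norm (g x - h x)) \<le> r / 4"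
      and lim: "(\<lambda>n. LINT x|lborel. norm (h (x - z n) - h x)) \<longlonglongrightarrow> 0"
    using approx [of "r / 4"] by auto
  from LIMSEQ_D [OF lim, of "r / 2"] \<open>r > 0\<close> obtain N where
    N: "\<And>n. n \<ge> N \<Longrightarrow> (LINT x|lborel. norm (h (x - z n) - h x)) < r / 2" by auto
  show "\<exists>N. \<forall>n\<ge>N. norm ((LINT x|lborel. norm (g (x - z n) - g x)) - 0) < r"
  proof (intro exI allI impI)
    fix n assume "n \<ge> N"
    then show "norm ((LINT x|lborel. norm (g (x - z n) - g x)) - 0) < r"
      using N [of n] h(2) L1_shift_triangle [OF g h(1), of "z n"] by simp
  qed
qed

text \<open>A point of the open set \<open>U\<close> stays in \<open>U\<close> under all small
  shifts. At boundary points the shifted indicators need not converge, so only the part of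
  \<open>U\<close> lost under the shift is treated pointwise; the part gained has the same
  measure.\<close>

lemma L1_shift_limit_open:
  fixes U :: "real set"
  assumes U: "open U" "emeasure lborel U < \<infinity>" and z: "z \<longlonglongrightarrow> 0"
  shows "(\<lambda>n. LINT x|lborel. \<bar>indicat_real U (x - z n) - indicat_real U x\<bar>) \<longlonglongrightarrow> 0"
proof -
  let ?p = "indicat_real U"
  let ?d = "\<lambda>n x. ?p x * (1 - ?p (x - z n))"
  have [measurable]: "U \<in> sets borel" using U by simp
  have int: "integrable lborel ?p" using U by simp
  have intd: "integrable lborel (?d n)" for n
    by (rule Bochner_Integration.integrable_bound [OF int]) (auto split: split_indicator)
  have "(\<lambda>n. LINT x|lborel. ?d n x) \<longlonglongrightarrow> (LINT x|(lborel :: real measure). 0)"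
  proof (rule integral_dominated_convergence [where w = ?p])
    have "(\<lambda>n. ?d n x) \<longlonglongrightarrow> 0" for x
    proof (cases "x \<in> U")
      case True
      have "(\<lambda>n. x - z n) \<longlonglongrightarrow> x" using tendsto_diff [OF tendsto_const z, of x] by simp
      then have "eventually (\<lambda>n. x - z n \<in> U) sequentially"
        using U(1) True by (rule topological_tendstoD)
      then have "eventually (\<lambda>n. ?d n x = 0) sequentially"
        by eventually_elim auto
      then show ?thesis by (rule tendsto_eventually)
    qed auto
    then show "AE x in lborel. (\<lambda>n. ?d n x) \<longlonglongrightarrow> 0" by simp
  qed (use int in \<open>auto split: split_indicator\<close>)
  then have lim: "(\<lambda>n. 2 * (LINT x|lborel. ?d n x)) \<longlonglongrightarrow> 0" by (auto intro: tendsto_eq_intros)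
  have "(LINT x|lborel. \<bar>?p (x - z n) - ?p x\<bar>) = 2 * (LINT x|lborel. ?d n x)" for n
  proof -
    \<comment> \<open>For \<open>p\<close>, \<open>q\<close> in \<open>{0, 1}\<close> one has
      \<open>\<bar>q - p\<bar> = (q - p) + 2 * p * (1 - q)\<close>, and \<open>q - p\<close>
      integrates to zero by translation invariance.\<close>
    have "(LINT x|lborel. \<bar>?p (x - z n) - ?p x\<bar>) =
        (LINT x|lborel. (?p (x - z n) - ?p x) + 2 * ?d n x)"
      by (intro Bochner_Integration.integral_cong) (auto split: split_indicator)
    also have "\<dots> = 2 * (LINT x|lborel. ?d n x)"
      using int intd [of n] integrable_lborel_shift [OF int, of "z n"]
      by (simp add: integral_lborel_shift [of ?p])
    finally show ?thesis .
  qed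
  then show ?thesis using lim by simp
qed

text \<open>Induction over integrable functions: indicators are approximated by those of open
  supersets, sums use the triangle inequality, and dominated limits use
  \<open>L1_shift_limit_approx\<close> again.\<close>

lemma L1_shift_limit:
  fixes g :: "real \<Rightarrow> 'b::{banach, second_countable_topology}"
  assumes g: "integrable lborel g" and z: "z \<longlonglongrightarrow> 0"
  shows "(\<lambda>n. LINT x|lborel. norm (g (x - z n) - g x)) \<longlonglongrightarrow> 0"
  using g
proof (induction rule: integrable_induct)
  case (base A c)
  show ?case
  proof (rule L1_shift_limit_approx)
    show "integrable lborel (\<lambda>x. indicat_real A x *\<^sub>R c)" using base by simp
    fix e :: real assume e: "e > 0"
    \<comment> \<open>The summand 1 keeps the denominator positive when
      \<open>c = 0\<close>.\<close>
    define e' where "e' = e / (1 + norm c)"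
    have e': "e' > 0" "e' * norm c \<le> e" using e
      by (simp_all add: e'_def add_pos_nonneg field_simps)
    obtain U where U: "open U" "A \<subseteq> U" "emeasure lborel (U - A) < e'"
      using outer_regular_lborel [of A e'] base e' by auto
    have [measurable]: "A \<in> sets borel" "U \<in> sets borel" using U base by simp_all
    have "emeasure lborel U = emeasure lborel A + emeasure lborel (U - A)"
      using U(2) by (subst plus_emeasure) (auto intro!: arg_cong [of _ _ "emeasure lborel"])
    also have "\<dots> < \<infinity>"
      using base U(3) ennreal_less_top [of e'] by (auto intro: order_less_trans)
    finally have finU: "emeasure lborel U < \<infinity>" .
    let ?h = "\<lambda>x. indicat_real U x *\<^sub>R c"
    have "(LINT x|lborel. norm (indicat_real A x *\<^sub>R c - ?h x)) =
          (LINT x|lborel. indicat_real (U - A) x * norm c)"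
      using U(2) by (intro Bochner_Integration.integral_cong) (auto simp: indicator_def)
    also have "\<dots> = measure lborel (U - A) * norm c" by simp
    also have "\<dots> \<le> e' * norm c"
      using U(3) e' by (intro mult_right_mono) (auto simp: measure_def enn2real_leI less_imp_le)
    also have "\<dots> \<le> e" by (rule e')
    finally have 1: "(LINT x|lborel. norm (indicat_real A x *\<^sub>R c - ?h x)) \<le> e" .
    have "(\<lambda>n. (LINT x|lborel. \<bar>indicat_real U (x - z n) - indicat_real U x\<bar>) * norm c)
        \<longlonglongrightarrow> 0"
      using tendsto_mult_right [OF L1_shift_limit_open [OF U(1) finU z], of "norm c"] by simp
    then have "(\<lambda>n. LINT x|lborel. norm (?h (x - z n) - ?h x)) \<longlonglongrightarrow> 0"
      by (simp add: scaleR_diff_left [symmetric])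
    then show "\<exists>h. integrable lborel h \<and>
        (LINT x|lborel. norm (indicat_real A x *\<^sub>R c - h x)) \<le> e \<and>
        (\<lambda>n. LINT x|lborel. norm (h (x - z n) - h x)) \<longlonglongrightarrow> 0"
      using 1 finU by (intro exI [of _ ?h]) simp
  qed
next
  case (add f g)
  note int0 = add(1,2) add(1,2) [THEN integrable_lborel_shift]
  have int: "integrable lborel (\<lambda>x. norm (f (x - z n) - f x))"
    "integrable lborel (\<lambda>x. norm (g (x - z n) - g x))" for n
    by (intro integrable_norm Bochner_Integration.integrable_diff int0)+
  show ?case
  proof (rule tendsto_sandwich [OF _ _ tendsto_const])
    show "(\<lambda>n. (LINT x|lborel. norm (f (x - z n) - f x)) +
               (LINT x|lborel. norm (g (x - z n) - g x))) \<longlonglongrightarrow> 0"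
      using tendsto_add [OF add.IH(1) add.IH(2)] by simp
    have "(LINT x|lborel. norm (f (x - z n) + g (x - z n) - (f x + g x))) \<le>
        (LINT x|lborel. norm (f (x - z n) - f x) + norm (g (x - z n) - g x))" for n
      by (intro integral_mono integrable_norm Bochner_Integration.integrable_diff
           Bochner_Integration.integrable_add int0) (simp only: add_diff_add norm_triangle_ineq)
    then show "\<forall>\<^sub>F n in sequentially. (LINT x|lborel. norm (f (x - z n) + g (x - z n) - (f x + g x)))
        \<le> (LINT x|lborel. norm (f (x - z n) - f x)) + (LINT x|lborel. norm (g (x - z n) - g x))"
      using int by simp
  qed simp
next
  case (lim f s)
  show ?case
  proof (rule L1_shift_limit_approx [OF lim.hyps(4)])
    fix e :: real assume "e > 0"
    have [measurable]: "s i \<in> borel_measurable borel" "f \<in> borel_measurable borel" for i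
      using lim.hyps(1) [of i] lim.hyps(4) by auto
    \<comment> \<open>The approximants satisfy \<open>norm (s i x) \<le> 2 * norm (f x)\<close>, so
      \<open>3 * norm (f x)\<close> dominates the difference.\<close>
    have "(\<lambda>i. LINT x|lborel. norm (f x - s i x)) \<longlonglongrightarrow> (LINT x|(lborel :: real measure). 0)"
    proof (rule integral_dominated_convergence [where w = "\<lambda>x. 3 * norm (f x)"])
      have "norm (f x - s i x) \<le> 3 * norm (f x)" for i x
        using lim.hyps(3) [of x i] norm_triangle_ineq4 [of "f x" "s i x"] by simp
      then show "AE x in lborel. norm (norm (f x - s i x)) \<le> 3 * norm (f x)" for i by simp
      have "(\<lambda>i. norm (f x - s i x)) \<longlonglongrightarrow> 0" for x
        using tendsto_norm [OF tendsto_diff [OF tendsto_const lim.hyps(2)], of x "f x"] by simp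
      then show "AE x in lborel. (\<lambda>i. norm (f x - s i x)) \<longlonglongrightarrow> 0" by simp
    qed (use lim.hyps(4) in auto)
    from LIMSEQ_D [OF this \<open>e > 0\<close>] obtain i where "(LINT x|lborel. norm (f x - s i x)) \<le> e"
      by (fastforce intro: less_imp_le)
    then show "\<exists>h. integrable lborel h \<and> (LINT x|lborel. norm (f x - h x)) \<le> e \<and>
      (\<lambda>n. LINT x|lborel. norm (h (x - z n) - h x)) \<longlonglongrightarrow> 0"
      using lim.hyps(1) lim.IH by blast
  qed
qed

text \<open>The Mazur map \<open>v \<mapsto> v * norm v\<close> sends \<open>L\<^sup>2\<close> to \<open>L\<^sup>1\<close>, and its inverse is Hoelder
  continuous, so continuity of translations passes from \<open>L\<^sup>1\<close> to \<open>L\<^sup>2\<close>.\<close>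
lemma norm_diff_power2_le_Mazur:
  fixes v w :: "'a::real_inner"
  shows "(norm (v - w))\<^sup>2 \<le> 2 * norm (norm v *\<^sub>R v - norm w *\<^sub>R w)"
proof (cases "v = w")
  case False
  define p q s where "p = norm v" "q = norm w" "s = inner v w"
  have sq: "(norm (v - w))\<^sup>2 = p\<^sup>2 + q\<^sup>2 - 2 * s"
    unfolding p_q_s_def power2_norm_eq_inner by (simp add: inner_diff inner_commute)
  have nn: "p \<ge> 0" "q \<ge> 0" by (auto simp: p_q_s_def)
  \<comment> \<open>The extra factor \<open>norm (v - w)\<close>, at most \<open>p + q\<close>,
    leads to an inner product that Cauchy-Schwarz can bound.\<close>
  have "norm (v - w) * (norm (v - w))\<^sup>2 \<le> (p + q) * (norm (v - w))\<^sup>2"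
    unfolding p_q_s_def by (intro mult_right_mono norm_triangle_ineq4) auto
  \<comment> \<open>The two sides differ by \<open>(p + q) * (p - q)^2\<close>.\<close>
  also have "\<dots> \<le> (p + q) * (2 * (p\<^sup>2 - p * q + q\<^sup>2 - s))"
    unfolding sq using nn sum_squares_bound [of p q] by (intro mult_left_mono) auto
  \<comment> \<open>After expanding the inner product this is
    \<open>p^3 + q^3 = (p + q) * (p^2 - p * q + q^2)\<close>.\<close>
  also have "\<dots> = 2 * inner (norm v *\<^sub>R v - norm w *\<^sub>R w) (v - w)"
  proof -
    have "inner v v = p\<^sup>2" "inner w w = q\<^sup>2" "inner v w = s" "inner w v = s"
      unfolding p_q_s_def by (simp_all add: power2_norm_eq_inner inner_commute)
    then show ?thesis
      by (simp add: inner_diff_left inner_diff_right p_q_s_def(1,2) [symmetric])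
        (simp add: algebra_simps power2_eq_square)
  qed
  also have "\<dots> \<le> 2 * (norm (norm v *\<^sub>R v - norm w *\<^sub>R w) * norm (v - w))"
    by (intro mult_left_mono norm_cauchy_schwarz) auto
  finally have "norm (v - w) * (norm (v - w))\<^sup>2 \<le>
      norm (v - w) * (2 * norm (norm v *\<^sub>R v - norm w *\<^sub>R w))"
    by (simp only: mult_ac)
  then show ?thesis using False by simp
qed simp

lemma L2_shift_limit:
  fixes f :: "real \<Rightarrow> complex"
  assumes f: "L2_on lborel f" and z: "z \<longlonglongrightarrow> 0"
  shows "(\<lambda>n. LINT x|lborel. (cmod (f (x - z n) - f x))\<^sup>2) \<longlonglongrightarrow> 0"
proof (rule tendsto_sandwich [OF _ _ tendsto_const])
  let ?g = "\<lambda>x. cmod (f x) *\<^sub>R f x"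
  have [measurable]: "f \<in> borel_measurable borel" using f by (simp add: L2_on_def)
  have g: "integrable lborel ?g"
    by (rule Bochner_Integration.integrable_bound [OF L2_on_integrable [OF f]])
       (auto simp: power2_eq_square)
  show "(\<lambda>n. 2 * (LINT x|lborel. norm (?g (x - z n) - ?g x))) \<longlonglongrightarrow> 0"
    using tendsto_mult_left [OF L1_shift_limit [OF g z], of 2] by simp
  have int: "integrable lborel (\<lambda>x. 2 * norm (?g (x - z n) - ?g x))" for n
    using g integrable_lborel_shift [OF g, of "z n"]
    by (intro integrable_mult_right integrable_norm Bochner_Integration.integrable_diff)
  have le: "(cmod (f (x - z n) - f x))\<^sup>2 \<le> 2 * norm (?g (x - z n) - ?g x)" for n x
    by (rule norm_diff_power2_le_Mazur)
  have "(LINT x|lborel. (cmod (f (x - z n) - f x))\<^sup>2) \<le>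
      (LINT x|lborel. 2 * norm (?g (x - z n) - ?g x))" for n
  proof (rule integral_mono)
    show "integrable lborel (\<lambda>x. (cmod (f (x - z n) - f x))\<^sup>2)"
      by (rule Bochner_Integration.integrable_bound [OF int [of n]]) (use le in simp_all)
  qed (rule int le)+
  then show "\<forall>\<^sub>F n in sequentially. (LINT x|lborel. (cmod (f (x - z n) - f x))\<^sup>2) \<le>
      2 * (LINT x|lborel. norm (?g (x - z n) - ?g x))" by simp
qed simp

section \<open>Phase factors and integrals over product measures\<close>

lemma borel_measurable_cis [measurable (raw)]:
  "f \<in> borel_measurable M \<Longrightarrow> (\<lambda>x. cis (f x)) \<in> borel_measurable M"
  by (rule borel_measurable_continuous_on [where f = cis]) (auto intro: continuous_intros)

lemma integrable_mult_cis:
  assumes "integrable M F" "g \<in> borel_measurable M"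
  shows "integrable M (\<lambda>x. F x * cis (g x))"
proof (rule Bochner_Integration.integrable_bound [OF assms(1)])
  show "(\<lambda>x. F x * cis (g x)) \<in> borel_measurable M"
    using assms by measurable
qed (simp add: norm_mult)

lemma (in pair_sigma_finite)
  fixes f :: "'a \<Rightarrow> 'c::{banach, second_countable_topology, real_normed_field}"
    and g :: "'b \<Rightarrow> 'c"
  assumes f: "integrable M1 f" and g: "integrable M2 g"
  shows integrable_mult_fst_snd: "integrable (M1 \<Otimes>\<^sub>M M2) (\<lambda>p. f (fst p) * g (snd p))"
    and integral_mult_fst_snd:
      "(LINT p|(M1 \<Otimes>\<^sub>M M2). f (fst p) * g (snd p)) = (LINT x|M1. f x) * (LINT y|M2. g y)"
proof -
  have [measurable]: "f \<in> borel_measurable M1" "g \<in> borel_measurable M2"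
    using f g by auto
  show int: "integrable (M1 \<Otimes>\<^sub>M M2) (\<lambda>p. f (fst p) * g (snd p))"
  proof (rule Fubini_integrable)
    show "integrable M1 (\<lambda>x. LINT y|M2. norm (f (fst (x, y)) * g (snd (x, y))))"
      using f by (simp add: norm_mult)
    show "AE x in M1. integrable M2 (\<lambda>y. f (fst (x, y)) * g (snd (x, y)))"
      using g by simp
  qed measurable
  from integral_fst' [OF int]
  show "(LINT p|(M1 \<Otimes>\<^sub>M M2). f (fst p) * g (snd p)) = (LINT x|M1. f x) * (LINT y|M2. g y)"
    by simp
qed

subsection \<open>The Parseval formula on the intersection of \<open>L\<^sup>1\<close> and \<open>L\<^sup>2\<close>\<close>

text \<open>Left unnormalised, so Parseval's formula carries \<open>2 * pi\<close>; the constant of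
  the transform kernel absorbs it later.\<close>

definition fourier :: "(real \<Rightarrow> complex) \<Rightarrow> real \<Rightarrow> complex" where
  "fourier F \<xi> = (LINT x|lborel. F x * cis (- (x * \<xi>)))"

lemma norm_fourier_le: "cmod (fourier F \<xi>) \<le> (LINT x|lborel. cmod (F x))"
  unfolding fourier_def by (rule order_trans [OF integral_norm_bound]) (simp add: norm_mult)

lemma borel_measurable_fourier [measurable]:
  assumes [measurable]: "F \<in> borel_measurable borel"
  shows "fourier F \<in> borel_measurable borel"
  unfolding fourier_def by measurable

lemma std_normal_density_fourier:
  "(LINT \<xi>|lborel. complex_of_real (std_normal_density \<xi>) * cis (s * \<xi>)) =
   complex_of_real (exp (- s\<^sup>2 / 2))"
proof -
  have "complex_of_real (exp (- s\<^sup>2 / 2)) = char std_normal_distribution s"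
    by (simp add: char_std_normal_distribution)
  also have "\<dots> = (LINT \<xi>|lborel. std_normal_density \<xi> *\<^sub>R cis (s * \<xi>))"
    unfolding char_def cis_conv_exp [symmetric] by (rule integral_density) auto
  finally show ?thesis by (simp add: scaleR_conv_of_real)
qed

text \<open>Rescaling the characteristic function of the normal law. As a function of
  \<open>s\<close> the value is \<open>sqrt (2 * pi)\<close> times a normal density of standard
  deviation \<open>e\<close>, so it concentrates at zero as \<open>e\<close> shrinks.\<close>

lemma std_normal_density_scaled_fourier:
  assumes "e > 0"
  shows "(LINT \<xi>|lborel. complex_of_real (std_normal_density (e * \<xi>)) * cis (- (s * \<xi>))) =
   complex_of_real (sqrt (2 * pi) / e * std_normal_density (s / e))"
proof -
  have "complex_of_real (exp (- (- s / e)\<^sup>2 / 2)) =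
     \<bar>e\<bar> *\<^sub>R (LINT \<xi>|lborel. complex_of_real (std_normal_density (0 + e * \<xi>)) * cis (- s / e * (0 + e * \<xi>)))"
    unfolding std_normal_density_fourier [symmetric]
    by (rule lborel_integral_real_affine) (use assms in simp)
  also have "\<dots> = complex_of_real e *
     (LINT \<xi>|lborel. complex_of_real (std_normal_density (e * \<xi>)) * cis (- (s * \<xi>)))"
    using assms by (simp add: scaleR_conv_of_real)
  finally show ?thesis
    using assms by (simp add: std_normal_density_def power_divide field_simps)
qed

text \<open>Written out, the left side is a triple integral that the Gaussian makes absolutely
  convergent. Integrating over \<open>\<xi>\<close> first leaves a narrow Gaussian in
  \<open>x - y\<close>, and a substitution turns the rest into an average of correlations.\<close>

lemma fourier_smoothed:
  assumes F: "integrable lborel F" "L2_on lborel F" and G: "integrable lborel G" "L2_on lborel G"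
    and e: "e > 0"
  shows "(LINT \<xi>|lborel. complex_of_real (std_normal_density (e * \<xi>)) *
             (fourier F \<xi> * cnj (fourier G \<xi>))) =
     complex_of_real (sqrt (2 * pi)) *
       (LINT z|lborel. complex_of_real (std_normal_density z) *
          (LINT x|lborel. F x * cnj (G (x - e * z))))"
proof -
  let ?n = "\<lambda>x. complex_of_real (std_normal_density x)"
  let ?P = "lborel \<Otimes>\<^sub>M lborel :: (real \<times> real) measure"
  let ?H = "\<lambda>p. F (fst p) * cnj (G (snd p))"
  let ?k = "\<lambda>s. complex_of_real (sqrt (2 * pi) / e * std_normal_density (s / e))"
  have [measurable]: "F \<in> borel_measurable borel" "G \<in> borel_measurable borel"
    using F G by auto
  interpret P: sigma_finite_measure ?P
    by (simp add: lborel_prod sigma_finite_lborel)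
  interpret Q: pair_sigma_finite "lborel :: real measure" ?P ..
  have cG: "integrable lborel (\<lambda>y. cnj (G y))" using G by simp
  have H: "integrable ?P ?H"
    by (rule lborel_pair.integrable_mult_fst_snd [OF F(1) cG])
  have prod: "fourier F \<xi> * cnj (fourier G \<xi>) = (LINT p|?P. ?H p * cis (- ((fst p - snd p) * \<xi>)))" for \<xi>
  proof -
    have "cnj (fourier G \<xi>) = (LINT y|lborel. cnj (G y * cis (- (y * \<xi>))))"
      unfolding fourier_def by (rule Bochner_Integration.integral_cnj [symmetric])
    then have "fourier F \<xi> * cnj (fourier G \<xi>) =
       (LINT x|lborel. F x * cis (- (x * \<xi>))) * (LINT y|lborel. cnj (G y) * cis (y * \<xi>))"
      by (simp add: fourier_def cis_cnj)
    also have "\<dots> = (LINT p|?P. (F (fst p) * cis (- (fst p * \<xi>))) * (cnj (G (snd p)) * cis (snd p * \<xi>)))"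
      by (rule lborel_pair.integral_mult_fst_snd [symmetric]) (auto intro!: integrable_mult_cis F cG)
    also have "\<dots> = (LINT p|?P. ?H p * cis (- ((fst p - snd p) * \<xi>)))"
    proof (rule Bochner_Integration.integral_cong)
      fix p :: "real \<times> real"
      have "cis (- ((fst p - snd p) * \<xi>)) = cis (- (fst p * \<xi>)) * cis (snd p * \<xi>)"
        by (simp add: cis_mult algebra_simps)
      then show "(F (fst p) * cis (- (fst p * \<xi>))) * (cnj (G (snd p)) * cis (snd p * \<xi>)) =
          ?H p * cis (- ((fst p - snd p) * \<xi>))" by (simp add: mult_ac)
    qed simp
    finally show ?thesis .
  qed
  have n: "integrable lborel (\<lambda>\<xi>. ?n (e * \<xi>))"
    using lborel_integrable_real_affine [of std_normal_density e 0] e by simp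
  have "integrable (lborel \<Otimes>\<^sub>M ?P) (\<lambda>q. ?n (e * fst q) * ?H (snd q))"
    by (rule Q.integrable_mult_fst_snd [OF n H])
  then have "integrable (lborel \<Otimes>\<^sub>M ?P)
      (\<lambda>q. ?n (e * fst q) * ?H (snd q) * cis (- ((fst (snd q) - snd (snd q)) * fst q)))"
    by (rule integrable_mult_cis) measurable
  then have int3: "integrable (lborel \<Otimes>\<^sub>M ?P)
      (\<lambda>(\<xi>, p). ?H p * (?n (e * \<xi>) * cis (- ((fst p - snd p) * \<xi>))))"
    by (simp add: split_beta' mult_ac)
  have "(LINT \<xi>|lborel. ?n (e * \<xi>) * (fourier F \<xi> * cnj (fourier G \<xi>))) =
      (LINT \<xi>|lborel. LINT p|?P. ?H p * (?n (e * \<xi>) * cis (- ((fst p - snd p) * \<xi>))))"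
    unfolding prod integral_mult_right_zero [symmetric] by (simp only: mult_ac)
  also have "\<dots> = (LINT p|?P. LINT \<xi>|lborel. ?H p * (?n (e * \<xi>) * cis (- ((fst p - snd p) * \<xi>))))"
    by (rule Q.Fubini_integral [OF int3, symmetric])
  also have "\<dots> = (LINT p|?P. ?H p * ?k (fst p - snd p))"
    unfolding integral_mult_right_zero std_normal_density_scaled_fourier [OF e] ..
  also have "\<dots> = (LINT x|lborel. LINT y|lborel. ?H (x, y) * ?k (fst (x, y) - snd (x, y)))"
  proof (rule lborel_pair.integral_fst' [symmetric])
    show "integrable ?P (\<lambda>p. ?H p * ?k (fst p - snd p))"
    proof (rule Bochner_Integration.integrable_bound)
      show "integrable ?P (\<lambda>p. complex_of_real (1 / e) * ?H p)" using H by simp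
      \<comment> \<open>Since \<open>e\<close> is fixed, a bound by \<open>1 / e\<close> is enough
        for integrability.\<close>
      have "sqrt (2 * pi) * std_normal_density s \<le> 1" for s
        by (simp add: std_normal_density_def)
      then have k: "cmod (?k s) \<le> 1 / e" for s
        using e by (simp add: norm_mult norm_divide divide_right_mono)
      show "AE p in ?P. norm (?H p * ?k (fst p - snd p)) \<le> norm (complex_of_real (1 / e) * ?H p)"
      proof (rule AE_I2)
        fix p
        have "norm (?H p * ?k (fst p - snd p)) \<le> cmod (?H p) * (1 / e)"
          unfolding norm_mult [of "?H p"] by (intro mult_left_mono k) simp
        also have "\<dots> = norm (complex_of_real (1 / e) * ?H p)"
          using e by (simp add: norm_mult norm_divide)
        finally show "norm (?H p * ?k (fst p - snd p)) \<le> norm (complex_of_real (1 / e) * ?H p)" .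
      qed
    qed measurable
  qed
  also have "\<dots> = (LINT x|lborel. LINT y|lborel. F x * cnj (G y) * ?k (x - y))"
    by (simp only: fst_conv snd_conv)
  also have "\<dots> = (LINT x|lborel. LINT z|lborel.
      complex_of_real (sqrt (2 * pi)) * (?n z * (F x * cnj (G (x - e * z)))))"
  proof (rule Bochner_Integration.integral_cong)
    fix x :: real
    \<comment> \<open>Substituting \<open>y = x - e * z\<close>: the Jacobian \<open>e\<close>
      cancels the \<open>1 / e\<close> in \<open>?k\<close>.\<close>
    have "(LINT y|lborel. F x * cnj (G y) * ?k (x - y)) =
       \<bar>- e\<bar> *\<^sub>R (LINT z|lborel. F x * cnj (G (x + - e * z)) * ?k (x - (x + - e * z)))"
      by (rule lborel_integral_real_affine) (use e in simp)
    also have "\<dots> = (LINT z|lborel. e *\<^sub>R (F x * cnj (G (x + - e * z)) * ?k (x - (x + - e * z))))"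
      using e by simp
    also have "\<dots> = (LINT z|lborel. complex_of_real (sqrt (2 * pi)) * (?n z * (F x * cnj (G (x - e * z)))))"
      using e by (intro Bochner_Integration.integral_cong) (auto simp: scaleR_conv_of_real)
    finally show "(LINT y|lborel. F x * cnj (G y) * ?k (x - y)) =
      (LINT z|lborel. complex_of_real (sqrt (2 * pi)) * (?n z * (F x * cnj (G (x - e * z)))))" .
  qed simp
  also have "\<dots> = complex_of_real (sqrt (2 * pi)) *
      (LINT x|lborel. LINT z|lborel. ?n z * (F x * cnj (G (x - e * z))))"
    by simp
  also have "(LINT x|lborel. LINT z|lborel. ?n z * (F x * cnj (G (x - e * z)))) =
      (LINT z|lborel. LINT x|lborel. ?n z * (F x * cnj (G (x - e * z))))"
  proof (rule lborel_pair.Fubini_integral)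
    have cGs: "L2_on lborel (\<lambda>x. cnj (G (x - s)))" for s
      by (intro L2_on_cnj L2_on_shift [OF G(2)])
    \<comment> \<open>By Cauchy-Schwarz and translation invariance, \<open>C\<close> bounds the
      correlation of the moduli for every shift, so a multiple of the Gaussian dominates the inner
      integrals.\<close>
    define C where "C = sqrt (LINT x|lborel. (cmod (F x))\<^sup>2) * sqrt (LINT x|lborel. (cmod (G x))\<^sup>2)"
    have C: "(LINT x|lborel. cmod (F x) * cmod (G (x - s))) \<le> C" for s
      using norm_integral_mult_le [OF F(2) cGs, of s]
        integral_lborel_shift [of "\<lambda>x. (cmod (G x))\<^sup>2" s] by (simp add: C_def)
    show "integrable (lborel \<Otimes>\<^sub>M lborel) (\<lambda>(z, x). ?n z * (F x * cnj (G (x - e * z))))"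
    proof (rule lborel_pair.Fubini_integrable)
      show "AE z in lborel. integrable lborel
          (\<lambda>x. case (z, x) of (z, x) \<Rightarrow> ?n z * (F x * cnj (G (x - e * z))))"
        using L2_on_mult_integrable [OF F(2) cGs] by simp
      show "integrable lborel (\<lambda>z. LINT x|lborel.
          norm (case (z, x) of (z, x) \<Rightarrow> ?n z * (F x * cnj (G (x - e * z)))))"
      proof (rule Bochner_Integration.integrable_bound)
        show "integrable lborel (\<lambda>z. std_normal_density z * C)" by simp
        show "AE z in lborel. norm (LINT x|lborel. norm
            (case (z, x) of (z, x) \<Rightarrow> ?n z * (F x * cnj (G (x - e * z)))))
           \<le> norm (std_normal_density z * C)"
        proof (rule AE_I2)
          fix z
          have "0 \<le> (LINT x|lborel. cmod (F x) * cmod (G (x - e * z)))" by simp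
          then show "norm (LINT x|lborel. norm
            (case (z, x) of (z, x) \<Rightarrow> ?n z * (F x * cnj (G (x - e * z)))))
           \<le> norm (std_normal_density z * C)"
            using C [of "e * z"] by (simp add: norm_mult abs_mult mult_left_mono)
        qed
      qed measurable
    qed measurable
  qed
  finally show ?thesis by simp
qed

text \<open>Cauchy-Schwarz reduces the difference to the L2 distance between \<open>G\<close> and
  its translate, which vanishes by \<open>L2_shift_limit\<close>.\<close>

lemma correlation_tendsto:
  fixes F G :: "real \<Rightarrow> complex"
  assumes F: "L2_on lborel F" and G: "L2_on lborel G" and s: "s \<longlonglongrightarrow> 0"
  shows "(\<lambda>n. LINT x|lborel. F x * cnj (G (x - s n))) \<longlonglongrightarrow>
         (LINT x|lborel. F x * cnj (G x))"
proof (rule LIM_zero_cancel, rule Lim_null_comparison)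
  have diff: "L2_on lborel (\<lambda>x. cnj (G (x - s n) - G x))" for n
    by (intro L2_on_cnj L2_on_diff L2_on_shift [OF G] G)
  have int: "integrable lborel (\<lambda>x. F x * cnj (G (x - s n)))"
    "integrable lborel (\<lambda>x. F x * cnj (G x))" for n
    by (intro L2_on_mult_integrable F L2_on_cnj L2_on_shift [OF G] G)+
  have "cmod ((LINT x|lborel. F x * cnj (G (x - s n))) - (LINT x|lborel. F x * cnj (G x))) \<le>
      sqrt (LINT x|lborel. (cmod (F x))\<^sup>2) * sqrt (LINT x|lborel. (cmod (G (x - s n) - G x))\<^sup>2)" for n
  proof -
    have "(LINT x|lborel. F x * cnj (G (x - s n))) - (LINT x|lborel. F x * cnj (G x)) =
        (LINT x|lborel. F x * cnj (G (x - s n) - G x))"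
      by (subst Bochner_Integration.integral_diff [OF int, symmetric])
         (simp add: right_diff_distrib)
    then show ?thesis using Cauchy_Schwarz_L2_on [OF F diff, of n] by (simp only: complex_mod_cnj)
  qed
  then show "\<forall>\<^sub>F n in sequentially.
     cmod ((LINT x|lborel. F x * cnj (G (x - s n))) - (LINT x|lborel. F x * cnj (G x))) \<le>
      sqrt (LINT x|lborel. (cmod (F x))\<^sup>2) * sqrt (LINT x|lborel. (cmod (G (x - s n) - G x))\<^sup>2)"
    by simp
  show "(\<lambda>n. sqrt (LINT x|lborel. (cmod (F x))\<^sup>2) *
      sqrt (LINT x|lborel. (cmod (G (x - s n) - G x))\<^sup>2)) \<longlonglongrightarrow> 0"
    using tendsto_mult_left [OF tendsto_real_sqrt [OF L2_shift_limit [OF G s]],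
        of "sqrt (LINT x|lborel. (cmod (F x))\<^sup>2)"] by simp
qed

text \<open>In the averaged form of \<open>fourier_smoothed\<close> the correlations are bounded and
  converge to the one at shift zero; dominated convergence applies against the Gaussian, whose mass
  is one.\<close>

lemma fourier_smoothed_tendsto:
  assumes F: "integrable lborel F" "L2_on lborel F" and G: "integrable lborel G" "L2_on lborel G"
    and e: "\<And>n. e n > 0" "e \<longlonglongrightarrow> 0"
  shows "(\<lambda>n. LINT \<xi>|lborel. complex_of_real (std_normal_density (e n * \<xi>)) *
             (fourier F \<xi> * cnj (fourier G \<xi>))) \<longlonglongrightarrow>
     complex_of_real (sqrt (2 * pi)) * (LINT x|lborel. F x * cnj (G x))"
proof -
  let ?n = "\<lambda>x. complex_of_real (std_normal_density x)"
  let ?c = "\<lambda>s. LINT x|lborel. F x * cnj (G (x - s))"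
  have [measurable]: "F \<in> borel_measurable borel" "G \<in> borel_measurable borel"
    using F G by auto
  define C where "C = sqrt (LINT x|lborel. (cmod (F x))\<^sup>2) * sqrt (LINT x|lborel. (cmod (G x))\<^sup>2)"
  have C: "cmod (?c s) \<le> C" for s
    using Cauchy_Schwarz_L2_on [OF F(2) L2_on_cnj [OF L2_on_shift [OF G(2), of s]]]
      integral_lborel_shift [of "\<lambda>x. (cmod (G x))\<^sup>2" s] by (simp add: C_def)
  have "(\<lambda>n. LINT z|lborel. ?n z * ?c (e n * z)) \<longlonglongrightarrow>
        (LINT z|lborel. ?n z * (LINT x|lborel. F x * cnj (G x)))"
  proof (rule integral_dominated_convergence [where w = "\<lambda>z. std_normal_density z * C"])
    have "(\<lambda>n. ?n z * ?c (e n * z)) \<longlonglongrightarrow> ?n z * (LINT x|lborel. F x * cnj (G x))" for z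
    proof (intro tendsto_mult tendsto_const correlation_tendsto F G)
      show "(\<lambda>n. e n * z) \<longlonglongrightarrow> 0" using tendsto_mult_right [OF e(2), of z] by simp
    qed
    then show "AE z in lborel. (\<lambda>n. ?n z * ?c (e n * z)) \<longlonglongrightarrow>
        ?n z * (LINT x|lborel. F x * cnj (G x))" by simp
    show "AE z in lborel. norm (?n z * ?c (e n * z)) \<le> std_normal_density z * C" for n
      using C by (auto simp: norm_mult intro!: mult_left_mono)
    show "integrable lborel (\<lambda>z. std_normal_density z * C)" by simp
  qed measurable
  moreover have "(LINT z|lborel. ?n z * (LINT x|lborel. F x * cnj (G x))) =
     (LINT x|lborel. F x * cnj (G x))"
    by simp
  ultimately show ?thesis
    unfolding fourier_smoothed [OF F G e(1)] by (intro tendsto_mult tendsto_const) simp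
qed

text \<open>As \<open>e n\<close> decreases, the Gaussian factors increase to their value at zero,
  and the smoothed integrals have a finite limit by \<open>fourier_smoothed_tendsto\<close> with
  \<open>G = F\<close>. Monotone convergence makes the limiting integrand integrable.\<close>

lemma L2_on_fourier:
  assumes F: "integrable lborel F" "L2_on lborel F"
  shows "L2_on lborel (fourier F)"
proof -
  have [measurable]: "F \<in> borel_measurable borel" using F by auto
  define e :: "nat \<Rightarrow> real" where "e n = 1 / real (Suc n)" for n
  have e: "e n > 0" for n by (simp add: e_def)
  have lim_e: "e \<longlonglongrightarrow> 0" unfolding e_def by (rule LIMSEQ_Suc [OF lim_1_over_n])
  have e_mono: "e n \<le> e m" if "m \<le> n" for m n
    using that by (simp add: e_def frac_le)
  define M where "M = (LINT x|lborel. cmod (F x))"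
  let ?f = "\<lambda>n \<xi>. std_normal_density (e n * \<xi>) * (cmod (fourier F \<xi>))\<^sup>2"
  have n: "integrable lborel (\<lambda>\<xi>. std_normal_density (e n * \<xi>))" for n
    using lborel_integrable_real_affine [of std_normal_density "e n" 0] e [of n] by simp
  \<comment> \<open>The transform is bounded by the L1 norm \<open>M\<close>, so for each
    \<open>n\<close> the Gaussian gives integrability.\<close>
  have int: "integrable lborel (?f n)" for n
  proof (rule Bochner_Integration.integrable_bound)
    show "integrable lborel (\<lambda>\<xi>. std_normal_density (e n * \<xi>) * M\<^sup>2)" using n by simp
    have "(cmod (fourier F \<xi>))\<^sup>2 \<le> M\<^sup>2" for \<xi>
      unfolding M_def by (intro power_mono norm_fourier_le) simp
    then show "AE \<xi> in lborel. norm (?f n \<xi>) \<le> norm (std_normal_density (e n * \<xi>) * M\<^sup>2)"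
      by (auto simp: abs_mult intro!: mult_left_mono)
  qed measurable
  have "(\<lambda>n. LINT \<xi>|lborel. complex_of_real (?f n \<xi>)) \<longlonglongrightarrow>
      complex_of_real (sqrt (2 * pi)) * (LINT x|lborel. F x * cnj (F x))"
    using fourier_smoothed_tendsto [OF F F e lim_e]
    by (simp only: complex_norm_square of_real_mult)
  then have "(\<lambda>n. complex_of_real (LINT \<xi>|lborel. ?f n \<xi>)) \<longlonglongrightarrow>
      complex_of_real (sqrt (2 * pi)) * (LINT x|lborel. F x * cnj (F x))"
    by (simp only: integral_complex_of_real)
  from tendsto_Re [OF this]
  obtain L where lim: "(\<lambda>n. LINT \<xi>|lborel. ?f n \<xi>) \<longlonglongrightarrow> L" by auto
  have "integrable lborel (\<lambda>\<xi>. std_normal_density 0 * (cmod (fourier F \<xi>))\<^sup>2)"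
  proof (rule integral_monotone_convergence_nonneg(1) [OF int _ _ _ lim])
    have "?f m \<xi> \<le> ?f n \<xi>" if "m \<le> n" for m n \<xi>
    proof (rule mult_right_mono)
      have "(e n * \<xi>)\<^sup>2 \<le> (e m * \<xi>)\<^sup>2"
        using e_mono [OF that] e [of n] by (simp add: power_mult_distrib mult_right_mono power_mono)
      then show "std_normal_density (e m * \<xi>) \<le> std_normal_density (e n * \<xi>)"
        by (simp add: std_normal_density_def divide_right_mono)
    qed simp
    then show "AE \<xi> in lborel. mono (\<lambda>n. ?f n \<xi>)" by (simp add: mono_def)
    have "(\<lambda>n. ?f n \<xi>) \<longlonglongrightarrow> std_normal_density 0 * (cmod (fourier F \<xi>))\<^sup>2" for \<xi>
      unfolding std_normal_density_def using lim_e
      by (auto intro!: tendsto_eq_intros)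
    then show "AE \<xi> in lborel. (\<lambda>n. ?f n \<xi>) \<longlonglongrightarrow>
        std_normal_density 0 * (cmod (fourier F \<xi>))\<^sup>2" by simp
  qed auto
  from integrable_mult_right [OF this, of "sqrt (2 * pi)"] show ?thesis
    by (simp add: L2_on_def std_normal_density_def)
qed

text \<open>Both transforms are in L2, so a multiple of their product dominates the smoothed
  integrands. The limit of the smoothed integrals is then known in two ways.\<close>

lemma fourier_Parseval:
  assumes F: "integrable lborel F" "L2_on lborel F" and G: "integrable lborel G" "L2_on lborel G"
  shows "(LINT \<xi>|lborel. fourier F \<xi> * cnj (fourier G \<xi>)) =
     complex_of_real (2 * pi) * (LINT x|lborel. F x * cnj (G x))"
proof -
  have [measurable]: "F \<in> borel_measurable borel" "G \<in> borel_measurable borel"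
    using F G by auto
  define e :: "nat \<Rightarrow> real" where "e n = 1 / real (Suc n)" for n
  have e: "e n > 0" for n by (simp add: e_def)
  have lim_e: "e \<longlonglongrightarrow> 0" unfolding e_def by (rule LIMSEQ_Suc [OF lim_1_over_n])
  let ?p = "\<lambda>\<xi>. fourier F \<xi> * cnj (fourier G \<xi>)"
  have int: "integrable lborel ?p"
    by (intro L2_on_mult_integrable L2_on_cnj L2_on_fourier F G)
  have le1: "std_normal_density x \<le> std_normal_density 0" for x
    by (simp add: std_normal_density_def divide_right_mono)
  have "(\<lambda>n. LINT \<xi>|lborel. complex_of_real (std_normal_density (e n * \<xi>)) * ?p \<xi>) \<longlonglongrightarrow>
      (LINT \<xi>|lborel. complex_of_real (std_normal_density 0) * ?p \<xi>)"
  proof (rule integral_dominated_convergence [where w = "\<lambda>\<xi>. std_normal_density 0 * cmod (?p \<xi>)"])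
    have "(\<lambda>n. std_normal_density (e n * \<xi>)) \<longlonglongrightarrow> std_normal_density 0" for \<xi>
      unfolding std_normal_density_def using lim_e
      by (auto intro!: tendsto_eq_intros)
    then show "AE \<xi> in lborel. (\<lambda>n. complex_of_real (std_normal_density (e n * \<xi>)) * ?p \<xi>)
        \<longlonglongrightarrow> complex_of_real (std_normal_density 0) * ?p \<xi>"
      by (auto intro!: tendsto_intros)
    show "AE \<xi> in lborel. norm (complex_of_real (std_normal_density (e n * \<xi>)) * ?p \<xi>) \<le>
        std_normal_density 0 * cmod (?p \<xi>)" for n
      using le1 by (auto simp: norm_mult intro!: mult_right_mono)
    show "integrable lborel (\<lambda>\<xi>. std_normal_density 0 * cmod (?p \<xi>))" using int by simp
  qed measurable
  from LIMSEQ_unique [OF this fourier_smoothed_tendsto [OF F G e lim_e]]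
  have "complex_of_real (std_normal_density 0) * (LINT \<xi>|lborel. ?p \<xi>) =
      complex_of_real (sqrt (2 * pi)) * (LINT x|lborel. F x * cnj (G x))"
    using int by simp
  \<comment> \<open>\<open>std_normal_density 0\<close> is \<open>1 / sqrt (2 * pi)\<close>, so this
    factor clears the left side and leaves \<open>2 * pi\<close> on the right.\<close>
  then have "complex_of_real (sqrt (2 * pi)) * (complex_of_real (std_normal_density 0) * (LINT \<xi>|lborel. ?p \<xi>)) =
      complex_of_real (sqrt (2 * pi)) * (complex_of_real (sqrt (2 * pi)) * (LINT x|lborel. F x * cnj (G x)))"
    by simp
  moreover have "sqrt (2 * pi) * std_normal_density 0 = 1" by (simp add: std_normal_density_def)
  moreover have "sqrt (2 * pi) * sqrt (2 * pi) = 2 * pi" by simp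
  ultimately show ?thesis
    by (simp only: mult.assoc [symmetric] of_real_mult [symmetric] of_real_1 mult_1_left)
qed

section \<open>Integration over all window positions\<close>

lemma integral_lborel_reflect:
  fixes q :: "real \<Rightarrow> 'b::{banach, second_countable_topology}"
  shows "(LINT w|lborel. q (t - w)) = (LINT w|lborel. q w)"
  using lborel_integral_real_affine [of "-1" q t] by simp

lemma integrable_lborel_reflect:
  fixes q :: "real \<Rightarrow> 'b::{banach, second_countable_topology}"
  assumes "integrable lborel q"
  shows "integrable lborel (\<lambda>w. q (t - w))"
  using lborel_integrable_real_affine [OF assms, of "-1" t] by simp

text \<open>For fixed \<open>t\<close> the map from \<open>w\<close> to \<open>t - w\<close>
  preserves Lebesgue measure, so integrating over \<open>w\<close> first decouples \<open>p\<close>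
  from \<open>q\<close>. It is applied both to squared moduli and to pairings of functions and
  windows.\<close>

lemma
  fixes p q :: "real \<Rightarrow> 'b::{banach, second_countable_topology, real_normed_field}"
  assumes p: "integrable lborel p" and q: "integrable lborel q"
  shows AE_integrable_shifted_product: "AE w in lborel. integrable lborel (\<lambda>t. p t * q (t - w))"
    and integrable_shifted_product: "integrable lborel (\<lambda>w. LINT t|lborel. p t * q (t - w))"
    and integral_shifted_product: "(LINT w|lborel. LINT t|lborel. p t * q (t - w)) =
      (LINT t|lborel. p t) * (LINT t|lborel. q t)"
proof -
  have [measurable]: "p \<in> borel_measurable borel" "q \<in> borel_measurable borel"
    using p q by auto
  have int: "integrable (lborel \<Otimes>\<^sub>M lborel) (\<lambda>(t, w). p t * q (t - w))"
  proof (rule lborel_pair.Fubini_integrable)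
    have "(LINT w|lborel. norm (p t * q (t - w))) = norm (p t) * (LINT w|lborel. norm (q w))" for t
      using integral_lborel_reflect [of "\<lambda>w. norm (q w)" t] by (simp add: norm_mult)
    then show "integrable lborel (\<lambda>t. LINT w|lborel. norm (case (t, w) of (t, w) \<Rightarrow> p t * q (t - w)))"
      using p by simp
    show "AE t in lborel. integrable lborel (\<lambda>w. case (t, w) of (t, w) \<Rightarrow> p t * q (t - w))"
      using integrable_lborel_reflect [OF q] by simp
  qed measurable
  show "AE w in lborel. integrable lborel (\<lambda>t. p t * q (t - w))"
    by (rule lborel_pair.AE_integrable_snd [OF int])
  show "integrable lborel (\<lambda>w. LINT t|lborel. p t * q (t - w))"
    by (rule lborel_pair.integrable_snd [OF int])
  have "(LINT w|lborel. LINT t|lborel. p t * q (t - w)) = (LINT t|lborel. LINT w|lborel. p t * q (t - w))"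
    by (rule lborel_pair.Fubini_integral [OF int])
  also have "\<dots> = (LINT t|lborel. p t * (LINT w|lborel. q w))"
    using integral_lborel_reflect [of q] by simp
  finally show "(LINT w|lborel. LINT t|lborel. p t * q (t - w)) =
      (LINT t|lborel. p t) * (LINT t|lborel. q t)"
    by simp
qed

subsection \<open>The offset linear canonical transform\<close>

text \<open>The factors are sorted for the integral over \<open>t\<close>: a part depending on
  \<open>u\<close> only, a unimodular chirp in \<open>t\<close>, and the Fourier kernel at frequency
  \<open>u / b\<close>.\<close>

lemma olct_kernel_eq:
  assumes "b \<noteq> 0"
  shows "olct_kernel (a, b, c, d, u0, w0) t u =
    1 / csqrt (\<i> * complex_of_real (2 * pi * b)) *
    cis (d / (2 * b) * (u\<^sup>2 + u0\<^sup>2) - 1 / b * u * (d * u0 - b * w0)) *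
    (cis (a / (2 * b) * t\<^sup>2 + 1 / b * t * u0) * cis (- (t * (u / b))))"
proof -
  have "cis (d / (2 * b) * (u\<^sup>2 + u0\<^sup>2) - 1 / b * u * (d * u0 - b * w0)) *
      (cis (a / (2 * b) * t\<^sup>2 + 1 / b * t * u0) * cis (- (t * (u / b)))) =
    cis (a / (2 * b) * t\<^sup>2 - 1 / b * t * (u - u0) - 1 / b * u * (d * u0 - b * w0)
          + d / (2 * b) * (u\<^sup>2 + u0\<^sup>2))"
    unfolding cis_mult by (rule arg_cong [of _ _ cis]) (use assms in \<open>simp add: field_simps\<close>)
  moreover have "\<i> * complex_of_real x - \<i> * complex_of_real y - \<i> * complex_of_real z +
      \<i> * complex_of_real v = \<i> * complex_of_real (x - y - z + v)" for x y z v
    by (simp add: algebra_simps)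
  ultimately show ?thesis
    by (simp only: olct_kernel.simps cis_conv_exp [symmetric] mult.assoc)
qed

text \<open>\<open>fst (snd A)\<close> is the parameter \<open>b\<close>. The exponentials are
  unimodular, so only the constant in front contributes.\<close>

lemma norm_olct_kernel:
  assumes "fst (snd A) \<noteq> 0"
  shows "cmod (olct_kernel A t u) = 1 / sqrt (2 * pi * \<bar>fst (snd A)\<bar>)"
proof -
  obtain a b c d u0 w0 where A: "A = (a, b, c, d, u0, w0)" by (cases A)
  then have b: "b \<noteq> 0" using assms by simp
  show ?thesis
    unfolding A olct_kernel_eq [OF b] by (simp add: norm_mult norm_divide abs_mult)
qed

lemma borel_measurable_olct_kernel [measurable (raw)]:
  assumes [measurable]: "g \<in> borel_measurable M" "h \<in> borel_measurable M"
  shows "(\<lambda>x. olct_kernel A (g x) (h x)) \<in> borel_measurable M"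
proof -
  obtain a b c d u0 w0 where A: "A = (a, b, c, d, u0, w0)" by (cases A)
  show ?thesis unfolding A olct_kernel.simps by measurable
qed

definition olct :: "olct_params \<Rightarrow> (real \<Rightarrow> complex) \<Rightarrow> real \<Rightarrow> complex" where
  "olct A F u = (LINT t|lborel. F t * olct_kernel A t u)"

text \<open>The chirp in \<open>t\<close> cancels in the pairing. The squared modulus
  \<open>1 / (2 * pi * \<bar>b\<bar>)\<close> of the remaining factor, the Jacobian
  \<open>\<bar>b\<bar>\<close> of \<open>\<xi> = u / b\<close> and the \<open>2 * pi\<close> of
  Parseval's formula multiply to one.\<close>

lemma
  assumes A: "fst (snd A) \<noteq> 0"
    and F: "integrable lborel F" "L2_on lborel F" and G: "integrable lborel G" "L2_on lborel G"
  shows L2_on_olct: "L2_on lborel (olct A F)"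
    and olct_Parseval: "(LINT u|lborel. olct A F u * cnj (olct A G u)) = (LINT t|lborel. F t * cnj (G t))"
proof -
  obtain a b c d u0 w0 where A_eq: "A = (a, b, c, d, u0, w0)" by (cases A)
  then have b: "b \<noteq> 0" using A by simp
  have [measurable]: "F \<in> borel_measurable borel" "G \<in> borel_measurable borel"
    using F G by auto
  let ?chirp = "\<lambda>t. cis (a / (2 * b) * t\<^sup>2 + 1 / b * t * u0)"
  let ?q = "\<lambda>u. 1 / csqrt (\<i> * complex_of_real (2 * pi * b)) *
    cis (d / (2 * b) * (u\<^sup>2 + u0\<^sup>2) - 1 / b * u * (d * u0 - b * w0))"
  let ?m = "\<lambda>F t. F t * ?chirp t"
  \<comment> \<open>The form \<open>0 + 1 / b * u\<close> matches the affine substitution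
    rule.\<close>
  have olct_eq: "olct A H u = ?q u * fourier (?m H) (0 + 1 / b * u)" for H u
  proof -
    have "0 + 1 / b * u = u / b" by simp
    then show ?thesis
      unfolding olct_def A_eq olct_kernel_eq [OF b] fourier_def integral_mult_right_zero [symmetric]
      by (simp only: mult_ac)
  qed
  have m: "integrable lborel (?m H)" "L2_on lborel (?m H)"
    if "integrable lborel H" "L2_on lborel H" for H
  proof -
    have [measurable]: "H \<in> borel_measurable borel" using that by auto
    show "integrable lborel (?m H)" by (rule integrable_mult_cis [OF that(1)]) measurable
    show "L2_on lborel (?m H)"
      by (rule L2_on_bound [OF that(2)]) (simp_all add: norm_mult)
  qed
  have q: "?q u * cnj (?q u) = complex_of_real (1 / (2 * pi * \<bar>b\<bar>))" for u
    unfolding complex_norm_square [symmetric]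
    by (simp add: norm_mult norm_divide power_divide abs_mult)
  have qn: "(cmod (?q u))\<^sup>2 = 1 / (2 * pi * \<bar>b\<bar>)" for u
    by (simp add: norm_mult norm_divide power_divide abs_mult)
  have scaled: "L2_on lborel (\<lambda>u. fourier (?m F) (0 + 1 / b * u))"
    using lborel_integrable_real_affine [OF L2_on_integrable [OF L2_on_fourier [OF m [OF F]]], of "1 / b" 0] b
    by (simp add: L2_on_def)
  show "L2_on lborel (olct A F)"
    unfolding L2_on_def
  proof
    show "integrable lborel (\<lambda>u. (cmod (olct A F u))\<^sup>2)"
      unfolding olct_eq norm_mult [of "?q _"] power_mult_distrib qn
      using L2_on_integrable [OF scaled] by (rule integrable_mult_right)
    show "olct A F \<in> borel_measurable lborel" unfolding olct_def by measurable
  qed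
  have "(LINT u|lborel. olct A F u * cnj (olct A G u)) =
    (LINT u|lborel. complex_of_real (1 / (2 * pi * \<bar>b\<bar>)) *
       (fourier (?m F) (0 + 1 / b * u) * cnj (fourier (?m G) (0 + 1 / b * u))))"
  proof -
    have "olct A F u * cnj (olct A G u) = (?q u * cnj (?q u)) *
        (fourier (?m F) (0 + 1 / b * u) * cnj (fourier (?m G) (0 + 1 / b * u)))" for u
      unfolding olct_eq by (simp only: complex_cnj_mult mult_ac)
    then show ?thesis by (simp only: q)
  qed
  also have "\<dots> = complex_of_real (1 / (2 * pi)) *
      (\<bar>1 / b\<bar> *\<^sub>R (LINT u|lborel. fourier (?m F) (0 + 1 / b * u) * cnj (fourier (?m G) (0 + 1 / b * u))))"
    by (simp add: scaleR_conv_of_real)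
  also have "\<bar>1 / b\<bar> *\<^sub>R (LINT u|lborel. fourier (?m F) (0 + 1 / b * u) * cnj (fourier (?m G) (0 + 1 / b * u))) =
      (LINT \<xi>|lborel. fourier (?m F) \<xi> * cnj (fourier (?m G) \<xi>))"
    by (rule lborel_integral_real_affine [symmetric]) (use b in simp)
  also have "\<dots> = complex_of_real (2 * pi) * (LINT t|lborel. ?m F t * cnj (?m G t))"
    by (rule fourier_Parseval [OF m [OF F] m [OF G]])
  also have "(LINT t|lborel. ?m F t * cnj (?m G t)) = (LINT t|lborel. F t * cnj (G t))"
  proof (rule Bochner_Integration.integral_cong)
    fix t
    have "?chirp t * cnj (?chirp t) = 1" by (simp add: cis_cnj cis_mult)
    then show "?m F t * cnj (?m G t) = F t * cnj (G t)" by (simp add: mult_ac)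
  qed simp
  finally show "(LINT u|lborel. olct A F u * cnj (olct A G u)) = (LINT t|lborel. F t * cnj (G t))"
    by simp
qed

subsection \<open>The windowed transform\<close>

lemma windowed_olct_eq_olct:
  "windowed_olct A \<phi> f u w = olct A (\<lambda>t. f t * cnj (\<phi> (t - w))) u"
  by (simp add: windowed_olct_def olct_def)

lemma borel_measurable_windowed_olct:
  assumes [measurable]: "f \<in> borel_measurable borel" "\<phi> \<in> borel_measurable borel"
    and [measurable]: "g \<in> borel_measurable M" "h \<in> borel_measurable M"
  shows "(\<lambda>x. windowed_olct A \<phi> f (g x) (h x)) \<in> borel_measurable M"
  unfolding windowed_olct_def by measurable

lemma integrable_windowed:
  fixes f \<phi> :: "real \<Rightarrow> complex"
  assumes "L2_on lborel f" "L2_on lborel \<phi>"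
  shows "integrable lborel (\<lambda>t. f t * cnj (\<phi> (t - w)))"
  by (rule L2_on_mult_integrable [OF assms(1) L2_on_cnj [OF L2_on_shift [OF assms(2)]]])

text \<open>A product of two L2 functions need not be in L2, so Parseval's formula is available only
  for almost every \<open>w\<close>, namely where the shifted product of the squared moduli is
  integrable.\<close>

lemma AE_L2_on_windowed:
  fixes f \<phi> :: "real \<Rightarrow> complex"
  assumes f: "L2_on lborel f" and \<phi>: "L2_on lborel \<phi>"
  shows "AE w in lborel. L2_on lborel (\<lambda>t. f t * cnj (\<phi> (t - w)))"
proof -
  have [measurable]: "f \<in> borel_measurable borel" "\<phi> \<in> borel_measurable borel"
    using f \<phi> by (auto simp: L2_on_def)
  from AE_integrable_shifted_product [OF L2_on_integrable [OF f] L2_on_integrable [OF \<phi>]]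
  show ?thesis
    by eventually_elim (simp add: L2_on_def norm_mult power_mult_distrib)
qed

text \<open>Parseval's formula in \<open>u\<close> for almost every \<open>w\<close>, followed by
  \<open>integral_shifted_product\<close> in \<open>w\<close>. The orthogonality relation takes its
  integrability from here.\<close>

lemma
  assumes A: "fst (snd A) \<noteq> 0" and f: "L2_on lborel f" and \<phi>: "L2_on lborel \<phi>"
  shows L2_on_windowed_olct:
      "L2_on (lborel \<Otimes>\<^sub>M lborel) (\<lambda>p. windowed_olct A \<phi> f (fst p) (snd p))"
    and norm_windowed_olct:
      "(LINT p|(lborel \<Otimes>\<^sub>M lborel). (cmod (windowed_olct A \<phi> f (fst p) (snd p)))\<^sup>2) =
       (LINT t|lborel. (cmod (f t))\<^sup>2) * (LINT t|lborel. (cmod (\<phi> t))\<^sup>2)"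
proof -
  let ?V = "\<lambda>p. windowed_olct A \<phi> f (fst p) (snd p)"
  let ?F = "\<lambda>w t. f t * cnj (\<phi> (t - w))"
  have [measurable]: "f \<in> borel_measurable borel" "\<phi> \<in> borel_measurable borel"
    using f \<phi> by (auto simp: L2_on_def)
  note [measurable] = borel_measurable_windowed_olct
  have sq: "(LINT u|lborel. (cmod (windowed_olct A \<phi> f u w))\<^sup>2) =
       (LINT t|lborel. (cmod (f t))\<^sup>2 * (cmod (\<phi> (t - w)))\<^sup>2)"
    if "L2_on lborel (?F w)" for w
  proof -
    note F = integrable_windowed [OF f \<phi>, of w] that
    have "complex_of_real (LINT u|lborel. (cmod (olct A (?F w) u))\<^sup>2) =
        complex_of_real (LINT t|lborel. (cmod (?F w t))\<^sup>2)"
      using olct_Parseval [OF A F F]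
      by (simp only: complex_norm_square [symmetric] integral_complex_of_real)
    then show ?thesis
      by (simp add: windowed_olct_eq_olct norm_mult power_mult_distrib)
  qed
  have AE_sq: "AE w in lborel. (LINT t|lborel. (cmod (f t))\<^sup>2 * (cmod (\<phi> (t - w)))\<^sup>2) =
       (LINT u|lborel. (cmod (windowed_olct A \<phi> f u w))\<^sup>2)"
    using AE_L2_on_windowed [OF f \<phi>] by eventually_elim (rule sq [symmetric])
  note int = L2_on_integrable [OF f] L2_on_integrable [OF \<phi>]
  \<comment> \<open>The coordinates are swapped so that the inner integral runs over
    \<open>u\<close>, where Parseval's formula applies.\<close>
  have "integrable (lborel \<Otimes>\<^sub>M lborel) (\<lambda>p. (cmod (windowed_olct A \<phi> f (snd p) (fst p)))\<^sup>2)"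
  proof (rule lborel_pair.Fubini_integrable)
    have "integrable lborel (\<lambda>w. LINT u|lborel. (cmod (windowed_olct A \<phi> f u w))\<^sup>2)"
      by (rule integrable_cong_AE_imp [OF integrable_shifted_product [OF int]])
         (use AE_sq in auto)
    then show "integrable lborel (\<lambda>w. LINT u|lborel.
        norm ((cmod (windowed_olct A \<phi> f (snd (w, u)) (fst (w, u))))\<^sup>2))" by simp
    show "AE w in lborel. integrable lborel
        (\<lambda>u. (cmod (windowed_olct A \<phi> f (snd (w, u)) (fst (w, u))))\<^sup>2)"
      using AE_L2_on_windowed [OF f \<phi>]
    proof eventually_elim
      case (elim w)
      note F = integrable_windowed [OF f \<phi>, of w] elim
      show ?case using L2_on_integrable [OF L2_on_olct [OF A F F]]
        by (simp add: windowed_olct_eq_olct)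
    qed
  qed measurable
  from lborel_pair.integrable_product_swap [OF this]
  have intV: "integrable (lborel \<Otimes>\<^sub>M lborel) (\<lambda>(u, w). (cmod (windowed_olct A \<phi> f u w))\<^sup>2)"
    by simp
  show "L2_on (lborel \<Otimes>\<^sub>M lborel) ?V"
    using intV by (simp add: L2_on_def split_beta')
  have "(LINT p|(lborel \<Otimes>\<^sub>M lborel). (cmod (?V p))\<^sup>2) =
      (LINT w|lborel. LINT u|lborel. (cmod (windowed_olct A \<phi> f u w))\<^sup>2)"
    unfolding lborel_pair.integral_snd [OF intV] by (simp add: split_beta')
  also have "\<dots> = (LINT w|lborel. LINT t|lborel. (cmod (f t))\<^sup>2 * (cmod (\<phi> (t - w)))\<^sup>2)"
    by (rule integral_cong_AE) (use AE_sq in \<open>auto elim: eventually_mono\<close>)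
  also have "\<dots> = (LINT t|lborel. (cmod (f t))\<^sup>2) * (LINT t|lborel. (cmod (\<phi> t))\<^sup>2)"
    by (rule integral_shifted_product [OF int])
  finally show "(LINT p|(lborel \<Otimes>\<^sub>M lborel). (cmod (?V p))\<^sup>2) =
       (LINT t|lborel. (cmod (f t))\<^sup>2) * (LINT t|lborel. (cmod (\<phi> t))\<^sup>2)" .
qed

text \<open>The polarised norm identity: after Parseval's formula in \<open>u\<close>, the integrand
  regroups into a product of the two signals and a shifted product of the two windows.\<close>

lemma windowed_olct_orthogonality:
  assumes A: "fst (snd A) \<noteq> 0" and f: "L2_on lborel f" and \<phi>: "L2_on lborel \<phi>"
    and k: "L2_on lborel k" and \<psi>: "L2_on lborel \<psi>"
  shows "(LINT p|(lborel \<Otimes>\<^sub>M lborel). windowed_olct A \<phi> f (fst p) (snd p) *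
             cnj (windowed_olct A \<psi> k (fst p) (snd p))) =
       (LINT t|lborel. f t * cnj (k t)) * L2_inner \<psi> \<phi>"
proof -
  have [measurable]: "f \<in> borel_measurable borel" "\<phi> \<in> borel_measurable borel"
    "k \<in> borel_measurable borel" "\<psi> \<in> borel_measurable borel"
    using f \<phi> k \<psi> by (auto simp: L2_on_def)
  note [measurable] = borel_measurable_windowed_olct
  let ?I = "\<lambda>u w. windowed_olct A \<phi> f u w * cnj (windowed_olct A \<psi> k u w)"
  have int: "integrable (lborel \<Otimes>\<^sub>M lborel) (\<lambda>(u, w). ?I u w)"
    using L2_on_mult_integrable [OF L2_on_windowed_olct [OF A f \<phi>]
        L2_on_cnj [OF L2_on_windowed_olct [OF A k \<psi>]]] by (simp add: split_beta')
  have "(LINT p|(lborel \<Otimes>\<^sub>M lborel). windowed_olct A \<phi> f (fst p) (snd p) *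
             cnj (windowed_olct A \<psi> k (fst p) (snd p))) = (LINT w|lborel. LINT u|lborel. ?I u w)"
    unfolding lborel_pair.integral_snd [OF int] by (simp add: split_beta')
  also have "\<dots> = (LINT w|lborel. LINT t|lborel. (f t * cnj (k t)) * (\<psi> (t - w) * cnj (\<phi> (t - w))))"
  proof (rule integral_cong_AE)
    show "AE w in lborel. (LINT u|lborel. ?I u w) =
        (LINT t|lborel. (f t * cnj (k t)) * (\<psi> (t - w) * cnj (\<phi> (t - w))))"
      using AE_L2_on_windowed [OF f \<phi>] AE_L2_on_windowed [OF k \<psi>]
    proof eventually_elim
      case (elim w)
      have "(LINT u|lborel. ?I u w) =
          (LINT t|lborel. (f t * cnj (\<phi> (t - w))) * cnj (k t * cnj (\<psi> (t - w))))"
        unfolding windowed_olct_eq_olct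
        by (rule olct_Parseval [OF A integrable_windowed [OF f \<phi>] elim(1)
              integrable_windowed [OF k \<psi>] elim(2)])
      then show ?case by (simp add: mult_ac)
    qed
  qed measurable
  also have "\<dots> = (LINT t|lborel. f t * cnj (k t)) * L2_inner \<psi> \<phi>"
    unfolding L2_inner_def
    by (rule integral_shifted_product) (intro L2_on_mult_integrable L2_on_cnj f k \<phi> \<psi>)+
  finally show ?thesis .
qed

section \<open>Synthesis over sets of finite measure\<close>

lemma (in pair_sigma_finite) L2_on_mult_fst_snd:
  assumes f: "L2_on M1 f" and g: "L2_on M2 g"
  shows "L2_on (M1 \<Otimes>\<^sub>M M2) (\<lambda>p. f (fst p) * g (snd p))"
proof -
  have [measurable]: "f \<in> borel_measurable M1" "g \<in> borel_measurable M2"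
    using f g by (auto simp: L2_on_def)
  show ?thesis
    using integrable_mult_fst_snd [OF L2_on_integrable [OF f] L2_on_integrable [OF g]]
    by (simp add: L2_on_def norm_mult power_mult_distrib)
qed

text \<open>The conjugate kernel replaces the inverse kernel, from which it differs by a unimodular
  constant. The indicator is part of the kernel so that, for \<open>K\<close> of finite measure, it
  is square integrable in all variables jointly.\<close>

definition windowed_synthesis_kernel ::
  "olct_params \<Rightarrow> (real \<Rightarrow> complex) \<Rightarrow> (real \<times> real) set \<Rightarrow> real \<times> real \<Rightarrow> real \<Rightarrow> complex" where
  "windowed_synthesis_kernel A \<psi> K p t =
     indicator K p * (cnj (olct_kernel A t (fst p)) * \<psi> (t - snd p))"

definition windowed_synthesis ::
  "olct_params \<Rightarrow> (real \<Rightarrow> complex) \<Rightarrow> (real \<times> real) set \<Rightarrow> (real \<times> real \<Rightarrow> complex) \<Rightarrow> real \<Rightarrow> complex" where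
  "windowed_synthesis A \<psi> K V t =
     (LINT p|(lborel \<Otimes>\<^sub>M lborel). V p * windowed_synthesis_kernel A \<psi> K p t)"

context
  fixes A :: olct_params and \<psi> :: "real \<Rightarrow> complex" and K :: "(real \<times> real) set"
  assumes A: "fst (snd A) \<noteq> 0" and \<psi>: "L2_on lborel \<psi>"
    and K: "K \<in> sets (lborel \<Otimes>\<^sub>M lborel)" "emeasure (lborel \<Otimes>\<^sub>M lborel) K < \<infinity>"
begin

private abbreviation "P \<equiv> (lborel \<Otimes>\<^sub>M lborel :: (real \<times> real) measure)"

interpretation P: sigma_finite_measure P
  by (simp add: lborel_prod sigma_finite_lborel)

interpretation Q: pair_sigma_finite P "lborel :: real measure" ..

lemma borel_measurable_windowed_synthesis_kernel:
  assumes g: "g \<in> measurable M P" and [measurable]: "h \<in> borel_measurable M"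
  shows "(\<lambda>x. windowed_synthesis_kernel A \<psi> K (g x) (h x)) \<in> borel_measurable M"
proof -
  have [measurable]: "\<psi> \<in> borel_measurable borel"
    using \<psi> by (auto simp: L2_on_def)
  have [measurable]: "(\<lambda>x. fst (g x)) \<in> borel_measurable M" "(\<lambda>x. snd (g x)) \<in> borel_measurable M"
    using measurable_compose [OF g measurable_fst] measurable_compose [OF g measurable_snd] by simp_all
  have [measurable]: "(\<lambda>x. indicator K (g x) :: complex) \<in> borel_measurable M"
    by (rule measurable_compose [OF g borel_measurable_indicator [OF K(1)]])
  show ?thesis unfolding windowed_synthesis_kernel_def by measurable
qed

private lemmas [measurable] = borel_measurable_windowed_synthesis_kernel

text \<open>The transform kernel has constant modulus and the norm of \<open>\<psi>\<close> is
  translation invariant, so the integral over \<open>t\<close> is a constant times the indicator of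
  \<open>K\<close>.\<close>

lemma L2_on_windowed_synthesis_kernel:
  "L2_on (P \<Otimes>\<^sub>M lborel) (\<lambda>q. windowed_synthesis_kernel A \<psi> K (fst q) (snd q))"
  unfolding L2_on_def
proof
  define c where "c = (1 / sqrt (2 * pi * \<bar>fst (snd A)\<bar>))\<^sup>2"
  have eq: "(cmod (windowed_synthesis_kernel A \<psi> K p t))\<^sup>2 =
      indicator K p * (c * (cmod (\<psi> (t - snd p)))\<^sup>2)" for p t
    unfolding windowed_synthesis_kernel_def c_def
    by (simp add: norm_mult power_mult_distrib power_divide norm_olct_kernel [OF A]
          split: split_indicator)
  show "integrable (P \<Otimes>\<^sub>M lborel) (\<lambda>q. (cmod (windowed_synthesis_kernel A \<psi> K (fst q) (snd q)))\<^sup>2)"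
  proof (rule Q.Fubini_integrable)
    have "(LINT t|lborel. norm ((cmod (windowed_synthesis_kernel A \<psi> K p t))\<^sup>2)) =
        indicator K p * (c * (LINT t|lborel. (cmod (\<psi> t))\<^sup>2))" for p
      using integral_lborel_shift [of "\<lambda>t. (cmod (\<psi> t))\<^sup>2" "snd p"] by (simp add: eq c_def)
    then show "integrable P (\<lambda>p. LINT t|lborel.
        norm ((cmod (windowed_synthesis_kernel A \<psi> K (fst (p, t)) (snd (p, t))))\<^sup>2))"
      using K by simp
    show "AE p in P. integrable lborel
        (\<lambda>t. (cmod (windowed_synthesis_kernel A \<psi> K (fst (p, t)) (snd (p, t))))\<^sup>2)"
      using integrable_lborel_shift [OF L2_on_integrable [OF \<psi>]] by (simp add: eq)
  qed measurable
qed measurable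

lemma
  shows AE_L2_on_windowed_synthesis_kernel:
      "AE t in lborel. L2_on P (\<lambda>p. windowed_synthesis_kernel A \<psi> K p t)"
    and integrable_norm_windowed_synthesis_kernel:
      "integrable lborel (\<lambda>t. LINT p|P. (cmod (windowed_synthesis_kernel A \<psi> K p t))\<^sup>2)"
proof -
  have int: "integrable (P \<Otimes>\<^sub>M lborel) (\<lambda>(p, t). (cmod (windowed_synthesis_kernel A \<psi> K p t))\<^sup>2)"
    using L2_on_integrable [OF L2_on_windowed_synthesis_kernel] by (simp add: split_beta')
  from Q.AE_integrable_snd [OF int]
  show "AE t in lborel. L2_on P (\<lambda>p. windowed_synthesis_kernel A \<psi> K p t)"
    by eventually_elim (simp add: L2_on_def)
  show "integrable lborel (\<lambda>t. LINT p|P. (cmod (windowed_synthesis_kernel A \<psi> K p t))\<^sup>2)"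
    by (rule Q.integrable_snd [OF int])
qed

lemma AE_integrable_windowed_synthesis:
  assumes V: "L2_on P V"
  shows "AE t in lborel. integrable P (\<lambda>p. V p * windowed_synthesis_kernel A \<psi> K p t)"
  using AE_L2_on_windowed_synthesis_kernel
  by eventually_elim (rule L2_on_mult_integrable [OF V])

text \<open>Cauchy-Schwarz over the plane for almost every \<open>t\<close>. The resulting bound
  grows with the measure of \<open>K\<close>; for transforms \<open>V\<close>, an estimate free of
  that measure is \<open>windowed_synthesis_error\<close>.\<close>

lemma L2_on_windowed_synthesis:
  assumes V: "L2_on P V"
  shows "L2_on lborel (windowed_synthesis A \<psi> K V)"
  unfolding L2_on_def
proof
  have [measurable]: "V \<in> borel_measurable P" using V by (rule L2_on_measurable)
  show meas: "windowed_synthesis A \<psi> K V \<in> borel_measurable lborel"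
    unfolding windowed_synthesis_def by measurable
  show "integrable lborel (\<lambda>t. (cmod (windowed_synthesis A \<psi> K V t))\<^sup>2)"
  proof (rule Bochner_Integration.integrable_bound)
    show "integrable lborel (\<lambda>t. (LINT p|P. (cmod (V p))\<^sup>2) *
        (LINT p|P. (cmod (windowed_synthesis_kernel A \<psi> K p t))\<^sup>2))"
      by (rule integrable_mult_right [OF integrable_norm_windowed_synthesis_kernel])
    show "(\<lambda>t. (cmod (windowed_synthesis A \<psi> K V t))\<^sup>2) \<in> borel_measurable lborel"
      using meas by measurable
    show "AE t in lborel. norm ((cmod (windowed_synthesis A \<psi> K V t))\<^sup>2) \<le>
      norm ((LINT p|P. (cmod (V p))\<^sup>2) * (LINT p|P. (cmod (windowed_synthesis_kernel A \<psi> K p t))\<^sup>2))"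
      using AE_L2_on_windowed_synthesis_kernel
    proof eventually_elim
      case (elim t)
      have "(cmod (windowed_synthesis A \<psi> K V t))\<^sup>2 \<le> (sqrt (LINT p|P. (cmod (V p))\<^sup>2) *
          sqrt (LINT p|P. (cmod (windowed_synthesis_kernel A \<psi> K p t))\<^sup>2))\<^sup>2"
        unfolding windowed_synthesis_def
        by (rule power_mono [OF Cauchy_Schwarz_L2_on [OF V elim]]) simp
      then show ?case by (simp add: power_mult_distrib abs_mult)
    qed
  qed
qed

text \<open>Fubini applies because the integrand is a product of two square-integrable functions of
  \<open>(p, t)\<close>: the tensor product of \<open>V\<close> with the conjugate of
  \<open>k\<close>, and the synthesis kernel.\<close>

lemma windowed_synthesis_adjoint:
  assumes V: "L2_on P V" and k: "L2_on lborel k"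
  shows "(LINT t|lborel. windowed_synthesis A \<psi> K V t * cnj (k t)) =
     (LINT p|P. (indicator K p * V p) * cnj (windowed_olct A \<psi> k (fst p) (snd p)))"
proof -
  let ?J = "\<lambda>p t. V p * cnj (k t) * windowed_synthesis_kernel A \<psi> K p t"
  have int: "integrable (P \<Otimes>\<^sub>M lborel) (\<lambda>(p, t). ?J p t)"
    using L2_on_mult_integrable [OF Q.L2_on_mult_fst_snd [OF V L2_on_cnj [OF k]]
        L2_on_windowed_synthesis_kernel] by (simp add: split_beta')
  have "(LINT t|lborel. windowed_synthesis A \<psi> K V t * cnj (k t)) = (LINT t|lborel. LINT p|P. ?J p t)"
    unfolding windowed_synthesis_def integral_mult_left_zero [symmetric]
    by (simp only: mult_ac)
  also have "\<dots> = (LINT p|P. LINT t|lborel. ?J p t)"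
    by (rule Q.Fubini_integral [OF int])
  also have "\<dots> = (LINT p|P. (indicator K p * V p) * cnj (windowed_olct A \<psi> k (fst p) (snd p)))"
  proof (rule Bochner_Integration.integral_cong)
    fix p
    have "(LINT t|lborel. ?J p t) = (LINT t|lborel. (indicator K p * V p) *
        cnj (k t * cnj (\<psi> (t - snd p)) * olct_kernel A t (fst p)))"
      by (rule Bochner_Integration.integral_cong) (simp_all add: windowed_synthesis_kernel_def mult_ac)
    also have "\<dots> = (indicator K p * V p) * cnj (windowed_olct A \<psi> k (fst p) (snd p))"
      unfolding windowed_olct_def Bochner_Integration.integral_cnj [symmetric]
      by (rule integral_mult_right_zero)
    finally show "(LINT t|lborel. ?J p t) =
        (indicator K p * V p) * cnj (windowed_olct A \<psi> k (fst p) (snd p))" .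
  qed simp
  finally show ?thesis .
qed

text \<open>By the orthogonality relation, the error tested against itself only sees the
  coefficients outside \<open>K\<close>.\<close>
lemma windowed_synthesis_error:
  assumes f: "L2_on lborel f" and \<phi>: "L2_on lborel \<phi>"
  defines "V \<equiv> \<lambda>p. windowed_olct A \<phi> f (fst p) (snd p)"
  shows "sqrt (LINT t|lborel. (cmod (windowed_synthesis A \<psi> K V t - L2_inner \<psi> \<phi> * f t))\<^sup>2) \<le>
     sqrt (LINT p|P. indicator (- K) p * (cmod (V p))\<^sup>2) * sqrt (LINT t|lborel. (cmod (\<psi> t))\<^sup>2)"
proof -
  have V: "L2_on P V" unfolding V_def by (rule L2_on_windowed_olct [OF A f \<phi>])
  define k where "k t = windowed_synthesis A \<psi> K V t - L2_inner \<psi> \<phi> * f t" for t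
  define W where "W p = cnj (windowed_olct A \<psi> k (fst p) (snd p))" for p
  note S = L2_on_windowed_synthesis [OF V]
  have k: "L2_on lborel k"
    unfolding k_def [abs_def] by (rule L2_on_diff [OF S L2_on_cmult [OF f]])
  have W: "L2_on P W"
    unfolding W_def [abs_def] by (rule L2_on_cnj [OF L2_on_windowed_olct [OF A k \<psi>]])
  \<comment> \<open>The norm identity with window \<open>\<psi>\<close> brings in the norm of
    \<open>\<psi>\<close>.\<close>
  have normW: "(LINT p|P. (cmod (W p))\<^sup>2) =
      (LINT t|lborel. (cmod (k t))\<^sup>2) * (LINT t|lborel. (cmod (\<psi> t))\<^sup>2)"
    unfolding W_def complex_mod_cnj by (rule norm_windowed_olct [OF A k \<psi>])
  have [measurable]: "V \<in> borel_measurable P" "K \<in> sets P"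
    using V K by (auto simp: L2_on_def)
  have VK: "L2_on P (\<lambda>p. indicator K p * V p)" and VK': "L2_on P (\<lambda>p. indicator (- K) p * V p)"
    by (rule L2_on_bound [OF V]; auto simp: norm_mult split: split_indicator)+
  define N where "N = (LINT t|lborel. (cmod (k t))\<^sup>2)"
  define E where "E = (LINT p|P. indicator (- K) p * (cmod (V p))\<^sup>2)"
  define G where "G = (LINT t|lborel. (cmod (\<psi> t))\<^sup>2)"
  have nn: "N \<ge> 0" "G \<ge> 0" by (simp_all add: N_def G_def)
  have "complex_of_real N = (LINT t|lborel. k t * cnj (k t))"
    unfolding N_def integral_complex_of_real [symmetric] complex_norm_square ..
  also have "\<dots> = (LINT t|lborel. windowed_synthesis A \<psi> K V t * cnj (k t) -
      L2_inner \<psi> \<phi> * (f t * cnj (k t)))"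
    by (simp add: k_def algebra_simps)
  also have "\<dots> = (LINT t|lborel. windowed_synthesis A \<psi> K V t * cnj (k t)) -
      L2_inner \<psi> \<phi> * (LINT t|lborel. f t * cnj (k t))"
    using L2_on_mult_integrable [OF S L2_on_cnj [OF k]] L2_on_mult_integrable [OF f L2_on_cnj [OF k]]
    by simp
  also have "(LINT t|lborel. windowed_synthesis A \<psi> K V t * cnj (k t)) =
      (LINT p|P. (indicator K p * V p) * W p)"
    unfolding W_def by (rule windowed_synthesis_adjoint [OF V k])
  \<comment> \<open>Orthogonality moves the second pairing to the plane with the same
    \<open>W\<close>, so the part over \<open>K\<close> cancels.\<close>
  also have "L2_inner \<psi> \<phi> * (LINT t|lborel. f t * cnj (k t)) = (LINT p|P. V p * W p)"
    unfolding W_def V_def windowed_olct_orthogonality [OF A f \<phi> k \<psi>] by (rule mult.commute)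
  also have "(LINT p|P. (indicator K p * V p) * W p) - (LINT p|P. V p * W p) =
      (LINT p|P. (indicator K p * V p) * W p - V p * W p)"
    by (rule Bochner_Integration.integral_diff [symmetric])
       (rule L2_on_mult_integrable [OF VK W] L2_on_mult_integrable [OF V W])+
  also have "\<dots> = (LINT p|P. - ((indicator (- K) p * V p) * W p))"
    by (rule Bochner_Integration.integral_cong) (auto split: split_indicator)
  also have "\<dots> = - (LINT p|P. (indicator (- K) p * V p) * W p)"
    by simp
  finally have "cmod (complex_of_real N) = cmod (LINT p|P. (indicator (- K) p * V p) * W p)"
    by simp
  also have "\<dots> \<le> sqrt (LINT p|P. (cmod (indicator (- K) p * V p))\<^sup>2) * sqrt (LINT p|P. (cmod (W p))\<^sup>2)"
    by (rule Cauchy_Schwarz_L2_on [OF VK' W])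
  also have "(LINT p|P. (cmod (indicator (- K) p * V p))\<^sup>2) = E"
    unfolding E_def by (rule Bochner_Integration.integral_cong) (auto split: split_indicator)
  finally have "N \<le> sqrt E * (sqrt N * sqrt G)"
    using nn by (simp add: normW N_def [symmetric] G_def [symmetric] real_sqrt_mult)
  then have "sqrt N * sqrt N \<le> sqrt N * (sqrt E * sqrt G)"
    using nn by (simp add: mult_ac)
  moreover have "E \<ge> 0" unfolding E_def by (simp add: integral_nonneg_AE)
  \<comment> \<open>For \<open>N = 0\<close> the bound is nonnegativity; otherwise
    \<open>sqrt N\<close> cancels.\<close>
  ultimately have "sqrt N \<le> sqrt E * sqrt G"
    using nn by (cases "N = 0") (auto intro: mult_left_le_imp_le [of "sqrt N"])
  then show ?thesis by (simp add: N_def E_def G_def k_def)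
qed

end

section \<open>The inversion formula along compact exhaustions\<close>

theorem mainTheorem7:
  fixes a b c d u0 w0 :: real
    and A :: olct_params
    and \<phi> \<psi> f :: "real \<Rightarrow> complex"
  assumes "A = (a, b, c, d, u0, w0)"
    and "a * d - b * c = 1" and "b \<noteq> 0"
    and "square_integrable \<phi>" and "\<not> (AE t in lborel. \<phi> t = 0)"
    and "square_integrable \<psi>" and "\<not> (AE t in lborel. \<psi> t = 0)"
    and "L2_inner \<psi> \<phi> \<noteq> 0"
    and "square_integrable f"
  shows "\<exists>h. has_L2_integral
               (\<lambda>(u, w) t. windowed_olct A \<phi> f u w * olct_kernel (olct_inverse A) u t * \<psi> (t - w)) h \<and>
             (AE t in lborel. f t =
               1 / L2_inner \<psi> \<phi> *
               exp (\<i> * complex_of_real (c * d / 2 * u0\<^sup>2)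
                    - \<i> * complex_of_real (a * d * u0 * w0)
                    + \<i> * complex_of_real (a * b / 2 * w0\<^sup>2)) * h t)"
proof -
  let ?P = "lborel \<Otimes>\<^sub>M lborel :: (real \<times> real) measure"
  let ?F = "\<lambda>(u, w) t. windowed_olct A \<phi> f u w * olct_kernel (olct_inverse A) u t * \<psi> (t - w)"
  define V where "V p = windowed_olct A \<phi> f (fst p) (snd p)" for p
  define e where "e = exp (\<i> * complex_of_real (c * d / 2 * u0\<^sup>2)
      - \<i> * complex_of_real (a * d * u0 * w0) + \<i> * complex_of_real (a * b / 2 * w0\<^sup>2))"
  \<comment> \<open>The inversion formula solved for the integral: \<open>cnj e\<close> is the
    inverse of the phase \<open>e\<close>.\<close>
  define h where "h t = cnj e * (L2_inner \<psi> \<phi> * f t)" for t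
  have A: "fst (snd A) \<noteq> 0" using assms by simp
  have L2: "L2_on lborel \<phi>" "L2_on lborel \<psi>" "L2_on lborel f"
    using assms by (simp_all add: square_integrable_eq_L2_on)
  have V: "L2_on ?P V"
    unfolding V_def [abs_def] by (rule L2_on_windowed_olct [OF A L2(3,1)])
  have "e = cis (c * d / 2 * u0\<^sup>2 - a * d * u0 * w0 + a * b / 2 * w0\<^sup>2)"
    unfolding e_def cis_conv_exp by (rule arg_cong [of _ _ exp]) (simp add: algebra_simps)
  then have norm_e: "cmod e = 1" by simp
  then have e: "e * cnj e = 1" by (simp add: complex_norm_square [symmetric])
  have kernel: "olct_kernel (olct_inverse A) u t = cnj e * cnj (olct_kernel A t u)" for u t
  proof -
    have "e * olct_kernel (olct_inverse A) u t = cnj (olct_kernel A t u)"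
      unfolding e_def assms(1) by (rule olct_kernel_inverse [OF assms(2,3)])
    then have "cnj e * cnj (olct_kernel A t u) = (e * cnj e) * olct_kernel (olct_inverse A) u t"
      by (simp add: mult_ac)
    then show ?thesis by (simp add: e)
  qed
  have h: "L2_on lborel h"
    unfolding h_def [abs_def] by (intro L2_on_cmult L2)
  have "has_L2_integral ?F h"
    unfolding has_L2_integral_def
  proof (intro conjI allI impI)
    show "square_integrable h" using h by (simp add: square_integrable_eq_L2_on)
    fix K :: "nat \<Rightarrow> (real \<times> real) set" assume "compact_exhaustion K"
    then have K: "\<And>n. compact (K n)" "incseq K" "(\<Union>n. K n) = UNIV"
      by (auto simp: compact_exhaustion_def)
    \<comment> \<open>Compact sets have finite Lebesgue measure, as the synthesis lemmas
      require.\<close>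
    have Ksets: "K n \<in> sets ?P" "emeasure ?P (K n) < \<infinity>" for n
      unfolding lborel_prod using K(1) [of n] emeasure_compact_finite [of "K n"]
      by (auto intro: borel_compact)
    note synth = A L2(2) Ksets
    let ?S = "\<lambda>n. windowed_synthesis A \<psi> (K n) V"
    \<comment> \<open>Passing from the inverse kernel to the conjugate one costs the factor
      \<open>cnj e\<close> and turns the set integral into a synthesis.\<close>
    have eq: "indicator (K n) p *\<^sub>R ?F p t =
        cnj e * (V p * windowed_synthesis_kernel A \<psi> (K n) p t)" for n p t
      by (auto simp: split_beta kernel V_def windowed_synthesis_kernel_def split: split_indicator)
    have integral_eq: "(LINT p:K n|lborel. ?F p t) = cnj e * ?S n t" for n t
      unfolding set_lebesgue_integral_def eq windowed_synthesis_def lborel_prod by simp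
    show "AE t in lborel. set_integrable lborel (K n) (\<lambda>p. ?F p t)" for n
      using AE_integrable_windowed_synthesis [OF synth V, of n]
      unfolding set_integrable_def eq lborel_prod
      by eventually_elim (rule integrable_mult_right)
    show "square_integrable (\<lambda>t. LINT p:K n|lborel. ?F p t)" for n
      unfolding integral_eq square_integrable_eq_L2_on
      by (rule L2_on_cmult [OF L2_on_windowed_synthesis [OF synth V]])
    let ?E = "\<lambda>n. LINT p|?P. indicator (- K n) p * (cmod (V p))\<^sup>2"
    let ?c = "sqrt (LINT t|lborel. (cmod (\<psi> t))\<^sup>2)"
    have bound: "L2_norm (\<lambda>t. (LINT p:K n|lborel. ?F p t) - h t) \<le> sqrt (?E n) * ?c" for n
    proof -
      have "(LINT p:K n|lborel. ?F p t) - h t = cnj e * (?S n t - L2_inner \<psi> \<phi> * f t)" for t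
        by (simp add: integral_eq h_def right_diff_distrib)
      then show ?thesis
        using windowed_synthesis_error [OF synth L2(3,1), of n]
        by (simp add: L2_norm_def norm_mult norm_e V_def [abs_def])
    qed
    have [measurable]: "V \<in> borel_measurable ?P" "K n \<in> sets ?P" for n
      using V Ksets by (auto simp: L2_on_def)
    \<comment> \<open>Every point lies in \<open>K n\<close> from some index on, so the integrand
      vanishes eventually at each point.\<close>
    have "?E \<longlonglongrightarrow> (LINT p|?P. 0)"
    proof (rule integral_dominated_convergence [where w = "\<lambda>p. (cmod (V p))\<^sup>2"])
      have "(\<lambda>n. indicator (- K n) p * (cmod (V p))\<^sup>2) \<longlonglongrightarrow> 0" for p
      proof -
        obtain m where m: "p \<in> K m" using K(3) by auto
        have "p \<in> K n" if "n \<ge> m" for n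
          using incseqD [OF K(2) that] m by auto
        then have "\<forall>\<^sub>F n in sequentially. indicator (- K n) p * (cmod (V p))\<^sup>2 = 0"
          unfolding eventually_sequentially by (intro exI [of _ m]) auto
        then show ?thesis by (rule tendsto_eventually)
      qed
      then show "AE p in ?P. (\<lambda>n. indicator (- K n) p * (cmod (V p))\<^sup>2) \<longlonglongrightarrow> 0" by simp
      show "integrable ?P (\<lambda>p. (cmod (V p))\<^sup>2)" using V by (rule L2_on_integrable)
      show "AE p in ?P. norm (indicator (- K n) p * (cmod (V p))\<^sup>2) \<le> (cmod (V p))\<^sup>2" for n
        by (auto split: split_indicator)
    qed measurable
    then have "?E \<longlonglongrightarrow> 0" by simp
    from tendsto_mult_right [OF tendsto_real_sqrt [OF this], of ?c]
    have "(\<lambda>n. sqrt (?E n) * ?c) \<longlonglongrightarrow> 0" by simp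
    then show "(\<lambda>n. L2_norm (\<lambda>t. (LINT p:K n|lborel. ?F p t) - h t)) \<longlonglongrightarrow> 0"
      by (rule tendsto_sandwich [OF _ _ tendsto_const, rotated 2])
         (use bound in \<open>simp_all add: L2_norm_def\<close>)
  qed
  moreover have "f t = 1 / L2_inner \<psi> \<phi> * e * h t" for t
  proof -
    have "1 / L2_inner \<psi> \<phi> * e * h t = (e * cnj e) * f t"
      using assms(8) by (simp add: h_def)
    then show ?thesis by (simp add: e)
  qed
  ultimately show ?thesis unfolding e_def [symmetric] by auto
qed

end
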